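(* Let $S$ be an aic of a commutative unital ring $R$, and let $F\subseteq\mathrm{reg}(R)$ be a (multiplicative) monoid. Then $F^{-1}S$ is an aic of $F^{-1}R$, and $F\subseteq\mathrm{reg}(S)$. If $S=R^+$ (i.e. $S$ is, up to isomorphism of $R$-algebras, the only aic of $R$), one also has $F^{-1}S=(F^{-1}R)^+$ (i.e. $F^{-1}S$ is, up to isomorphism of $F^{-1}R$-algebras, the only aic of $F^{-1}R$).
   Context: All rings are commutative and unital. $\mathrm{reg}(R)$ denotes the set of regular elements (non-zero-divisors) of $R$. A ring extension $R\subseteq S$ is tight if every non-zero ideal of $S$ has non-zero intersection with $R$. A ring $S$ is absolutely integrally closed (ai closed) if every monic polynomial in $S[X]$ factorizes as a product of monic linear polynomials in $S[X]$ (uniqueness of the factorization is not required). An absolute integral closure (aic) of $R$ is an extension ring $S\supseteq R$ that is ai closed, integral over $R$ and tight over $R$. If all aics of $R$ are isomorphic as $R$-algebras, the unique aic is denoted $R^+$. *)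

theory Defs
  imports "HOL-Algebra.Multiplicative_Group" "HOL-Algebra.QuotRing"
begin

section \<open>Regular elements\<close>

definition reg :: "('a, 'm) ring_scheme \<Rightarrow> 'a set" where
  "reg R = {a \<in> carrier R. \<forall>x \<in> carrier R. a \<otimes>\<^bsub>R\<^esub> x = \<zero>\<^bsub>R\<^esub> \<longrightarrow> x = \<zero>\<^bsub>R\<^esub>}"


section \<open>Ring extensions and absolute integral closures\<close>

text \<open>
  An extension \<open>R \<subseteq> S\<close> is given by its structure map: an injective unital ring homomorphism
  \<open>i\<close> from \<open>R\<close> to \<open>S\<close>.  Thus \<open>i ` carrier R\<close> plays the role of \<open>R\<close> inside \<open>S\<close>, and a ring of
  fractions of \<open>S\<close> can be an extension of a ring of fractions of \<open>R\<close>.  The zero ring is allowed.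
\<close>

definition ring_extension ::
    "('a, 'm) ring_scheme \<Rightarrow> ('b, 'n) ring_scheme \<Rightarrow> ('a \<Rightarrow> 'b) \<Rightarrow> bool" where
  "ring_extension R S i \<longleftrightarrow> ring_hom_cring R S i \<and> inj_on i (carrier R)"

definition tight :: "('a, 'm) ring_scheme \<Rightarrow> ('b, 'n) ring_scheme \<Rightarrow> ('a \<Rightarrow> 'b) \<Rightarrow> bool" where
  "tight R S i \<longleftrightarrow>
     (\<forall>J. ideal J S \<longrightarrow> J \<noteq> {\<zero>\<^bsub>S\<^esub>} \<longrightarrow> J \<inter> i ` carrier R \<noteq> {\<zero>\<^bsub>S\<^esub>})"

definition monic :: "('a, 'm) ring_scheme \<Rightarrow> (nat \<Rightarrow> 'a) \<Rightarrow> bool" where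
  "monic R p \<longleftrightarrow> p \<in> carrier (UP R) \<and> coeff (UP R) p (deg R p) = \<one>\<^bsub>R\<^esub>"

definition integral_over :: "('a, 'm) ring_scheme \<Rightarrow> ('b, 'n) ring_scheme \<Rightarrow> ('a \<Rightarrow> 'b) \<Rightarrow> bool" where
  "integral_over R S i \<longleftrightarrow>
     (\<forall>s \<in> carrier S. \<exists>p. monic R p \<and> eval R S i s p = \<zero>\<^bsub>S\<^esub>)"

text \<open>The monic linear polynomial \<open>X - a\<close>.\<close>

definition monic_linear :: "('a, 'm) ring_scheme \<Rightarrow> 'a \<Rightarrow> nat \<Rightarrow> 'a" where
  "monic_linear S a = monom (UP S) \<one>\<^bsub>S\<^esub> 1 \<ominus>\<^bsub>UP S\<^esub> monom (UP S) a 0"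

definition ai_closed :: "('a, 'm) ring_scheme \<Rightarrow> bool" where
  "ai_closed S \<longleftrightarrow>
     (\<forall>p. monic S p \<longrightarrow>
        (\<exists>(n::nat) a. a \<in> {..<n} \<rightarrow> carrier S \<and>
           p = (\<Otimes>\<^bsub>UP S\<^esub> k \<in> {..<n}. monic_linear S (a k))))"

definition is_aic :: "('a, 'm) ring_scheme \<Rightarrow> ('b, 'n) ring_scheme \<Rightarrow> ('a \<Rightarrow> 'b) \<Rightarrow> bool" where
  "is_aic R S i \<longleftrightarrow>
     ring_extension R S i \<and> ai_closed S \<and> integral_over R S i \<and> tight R S i"

definition algebra_isomorphic ::
    "('a, 'm) ring_scheme \<Rightarrow> ('b, 'n) ring_scheme \<Rightarrow> ('a \<Rightarrow> 'b)
       \<Rightarrow> ('c, 'l) ring_scheme \<Rightarrow> ('a \<Rightarrow> 'c) \<Rightarrow> bool" where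
  "algebra_isomorphic R S i T j \<longleftrightarrow>
     (\<exists>h \<in> ring_iso S T. \<forall>r \<in> carrier R. h (i r) = j r)"

text \<open>
  \<open>S = R\<^sup>+\<close>: every aic \<open>T\<close> of \<open>R\<close> is isomorphic to the aic \<open>S\<close> as an \<open>R\<close>-algebra.  A formula of
  HOL cannot quantify over types, so the type of the elements of the competitors \<open>T\<close> is a
  parameter.  As \<open>R\<close> need not be a subset of \<open>T\<close>, this type is independent of that of \<open>R\<close>.
  A theorem ``uniqueness for \<open>R\<close> implies uniqueness for \<open>R'\<close>'' with the same arbitrary type
  \<open>'t\<close> on both sides entails the version in which each side quantifies over all types.
\<close>

definition is_unique_aic ::
    "'t itself \<Rightarrow> ('a, 'm) ring_scheme \<Rightarrow> ('b, 'n) ring_scheme \<Rightarrow> ('a \<Rightarrow> 'b) \<Rightarrow> bool" where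
  "is_unique_aic (_ :: 't itself) R S i \<longleftrightarrow>
     is_aic R S i \<and>
     (\<forall>(T :: 't ring) j. is_aic R T j \<longrightarrow> algebra_isomorphic R S i T j)"


section \<open>Rings of fractions\<close>

text \<open>
  \<open>loc R F\<close> is \<open>F\<^sup>-\<^sup>1R\<close>: pairs \<open>(a, f)\<close> modulo \<open>(a, f) \<sim> (b, g)\<close> iff \<open>t(ag - bf) = 0\<close> for some
  \<open>t \<in> F\<close>.  The elements are equivalence classes, and the operations are the usual ones on
  representatives; the unions below are over copies of a single class.
\<close>

definition fracrel :: "('a, 'm) ring_scheme \<Rightarrow> 'a set \<Rightarrow> (('a \<times> 'a) \<times> ('a \<times> 'a)) set" where
  "fracrel R F = {((a, f), (b, g)). a \<in> carrier R \<and> f \<in> F \<and> b \<in> carrier R \<and> g \<in> F \<and>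
     (\<exists>t \<in> F. t \<otimes>\<^bsub>R\<^esub> (a \<otimes>\<^bsub>R\<^esub> g \<ominus>\<^bsub>R\<^esub> b \<otimes>\<^bsub>R\<^esub> f) = \<zero>\<^bsub>R\<^esub>)}"

definition fraction :: "('a, 'm) ring_scheme \<Rightarrow> 'a set \<Rightarrow> 'a \<Rightarrow> 'a \<Rightarrow> ('a \<times> 'a) set" where
  "fraction R F a f = fracrel R F `` {(a, f)}"

definition loc :: "('a, 'm) ring_scheme \<Rightarrow> 'a set \<Rightarrow> ('a \<times> 'a) set ring" where
  "loc R F =
     \<lparr>carrier = (carrier R \<times> F) // fracrel R F,
      mult = (\<lambda>x y. \<Union>(a, f) \<in> x. \<Union>(b, g) \<in> y. fraction R F (a \<otimes>\<^bsub>R\<^esub> b) (f \<otimes>\<^bsub>R\<^esub> g)),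
      one = fraction R F \<one>\<^bsub>R\<^esub> \<one>\<^bsub>R\<^esub>,
      zero = fraction R F \<zero>\<^bsub>R\<^esub> \<one>\<^bsub>R\<^esub>,
      add = (\<lambda>x y. \<Union>(a, f) \<in> x. \<Union>(b, g) \<in> y.
               fraction R F (a \<otimes>\<^bsub>R\<^esub> g \<oplus>\<^bsub>R\<^esub> b \<otimes>\<^bsub>R\<^esub> f) (f \<otimes>\<^bsub>R\<^esub> g))\<rparr>"

text \<open>The induced map \<open>a/f \<mapsto> i(a)/i(f)\<close> from \<open>F\<^sup>-\<^sup>1R\<close> to \<open>F\<^sup>-\<^sup>1S\<close>, that is \<open>(i ` F)\<^sup>-\<^sup>1S\<close>.\<close>

definition loc_map ::
    "('b, 'n) ring_scheme \<Rightarrow> 'a set \<Rightarrow> ('a \<Rightarrow> 'b) \<Rightarrow> ('a \<times> 'a) set \<Rightarrow> ('b \<times> 'b) set" where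
  "loc_map S F i x = (\<Union>(a, f) \<in> x. fraction S (i ` F) (i a) (i f))"

locale loc_data = cring R + F: submonoid F R for R (structure) and F
begin

lemma den_closed [simp]: "f \<in> F \<Longrightarrow> f \<in> carrier R"
  using F.subset by blast

lemma fracrel_iff:
  "((a, f), (b, g)) \<in> fracrel R F \<longleftrightarrow>
     a \<in> carrier R \<and> f \<in> F \<and> b \<in> carrier R \<and> g \<in> F \<and>
     (\<exists>t \<in> F. t \<otimes> (a \<otimes> g) = t \<otimes> (b \<otimes> f))"
proof -
  have "t \<otimes> (a \<otimes> g \<ominus> b \<otimes> f) = \<zero> \<longleftrightarrow> t \<otimes> (a \<otimes> g) = t \<otimes> (b \<otimes> f)"
    if "a \<in> carrier R" "f \<in> F" "b \<in> carrier R" "g \<in> F" "t \<in> F" for t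
  proof -
    have "t \<otimes> (a \<otimes> g \<ominus> b \<otimes> f) = t \<otimes> (a \<otimes> g) \<ominus> t \<otimes> (b \<otimes> f)"
      using that by (simp add: a_minus_def r_distr r_minus)
    then show ?thesis
      using that by simp
  qed
  then show ?thesis
    unfolding fracrel_def by auto
qed

lemma fracrel_equiv: "equiv (carrier R \<times> F) (fracrel R F)"
proof (rule equivI)
  show "fracrel R F \<subseteq> (carrier R \<times> F) \<times> (carrier R \<times> F)"
    unfolding fracrel_def by auto
  show "refl_on (carrier R \<times> F) (fracrel R F)"
    by (auto simp: refl_on_def fracrel_iff intro: bexI[of _ \<one>])
  show "sym (fracrel R F)"
    by (auto simp: sym_def fracrel_iff) (metis)
  show "trans (fracrel R F)"
  proof (rule transI, clarify)
    fix a f b g c h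
    assume "((a, f), (b, g)) \<in> fracrel R F" "((b, g), (c, h)) \<in> fracrel R F"
    then obtain t u
      where cl: "a \<in> carrier R" "f \<in> F" "b \<in> carrier R" "g \<in> F" "c \<in> carrier R" "h \<in> F"
          "t \<in> F" "u \<in> F"
        and t: "t \<otimes> (a \<otimes> g) = t \<otimes> (b \<otimes> f)" and u: "u \<otimes> (b \<otimes> h) = u \<otimes> (c \<otimes> g)"
      by (auto simp: fracrel_iff)
    have "(t \<otimes> u \<otimes> g) \<otimes> (a \<otimes> h) = (u \<otimes> h) \<otimes> (t \<otimes> (a \<otimes> g))"
      using cl by (simp add: m_ac)
    also have "\<dots> = (t \<otimes> f) \<otimes> (u \<otimes> (b \<otimes> h))"
      unfolding t using cl by (simp add: m_ac)
    also have "\<dots> = (t \<otimes> u \<otimes> g) \<otimes> (c \<otimes> f)"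
      unfolding u using cl by (simp add: m_ac)
    finally show "((a, f), (c, h)) \<in> fracrel R F"
      using cl by (auto simp: fracrel_iff intro!: bexI[of _ "t \<otimes> u \<otimes> g"])
  qed
qed

lemma fraction_eq_iff:
  assumes "a \<in> carrier R" "f \<in> F" "b \<in> carrier R" "g \<in> F"
  shows "fraction R F a f = fraction R F b g \<longleftrightarrow> (\<exists>t \<in> F. t \<otimes> (a \<otimes> g) = t \<otimes> (b \<otimes> f))"
  unfolding fraction_def
  using eq_equiv_class_iff[OF fracrel_equiv, of "(a, f)" "(b, g)"] assms
  by (simp add: fracrel_iff)

lemma carrier_loc: "carrier (loc R F) = {fraction R F a f | a f. a \<in> carrier R \<and> f \<in> F}"
  unfolding loc_def fraction_def quotient_def by auto

lemma mult_loc: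
  assumes "a \<in> carrier R" "f \<in> F" "b \<in> carrier R" "g \<in> F"
  shows "fraction R F a f \<otimes>\<^bsub>loc R F\<^esub> fraction R F b g = fraction R F (a \<otimes> b) (f \<otimes> g)"
proof -
  have "(\<lambda>(a, f) (b, g). fraction R F (a \<otimes> b) (f \<otimes> g)) respects2 (fracrel R F)"
  proof (rule congruent2_commuteI[OF fracrel_equiv], goal_cases)
    case (1 y z)
    then show ?case
      by (auto simp: m_comm)
  next
    case (2 y z w)
    then obtain a f b g c h t where eq: "y = (a, f)" "z = (b, g)" "w = (c, h)"
      and cl: "a \<in> carrier R" "f \<in> F" "b \<in> carrier R" "g \<in> F" "c \<in> carrier R" "h \<in> F" "t \<in> F"
      and t: "t \<otimes> (a \<otimes> g) = t \<otimes> (b \<otimes> f)"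
      by (cases y, cases z, cases w) (auto simp: fracrel_iff)
    have "t \<otimes> ((c \<otimes> a) \<otimes> (h \<otimes> g)) = (c \<otimes> h) \<otimes> (t \<otimes> (a \<otimes> g))"
      using cl by (simp add: m_ac)
    also have "\<dots> = t \<otimes> ((c \<otimes> b) \<otimes> (h \<otimes> f))"
      unfolding t using cl by (simp add: m_ac)
    finally show ?case
      using cl by (auto simp: eq fraction_eq_iff)
  qed
  from UN_equiv_class2[OF fracrel_equiv fracrel_equiv this, of "(a, f)" "(b, g)"] assms
  show ?thesis
    by (simp add: loc_def fraction_def split_def)
qed

lemma add_loc:
  assumes "a \<in> carrier R" "f \<in> F" "b \<in> carrier R" "g \<in> F"
  shows "fraction R F a f \<oplus>\<^bsub>loc R F\<^esub> fraction R F b g = fraction R F (a \<otimes> g \<oplus> b \<otimes> f) (f \<otimes> g)"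
proof -
  have "(\<lambda>(a, f) (b, g). fraction R F (a \<otimes> g \<oplus> b \<otimes> f) (f \<otimes> g)) respects2 (fracrel R F)"
  proof (rule congruent2_commuteI[OF fracrel_equiv], goal_cases)
    case (1 y z)
    then show ?case
      by (auto simp: m_comm a_comm)
  next
    case (2 y z w)
    then obtain a f b g c h t where eq: "y = (a, f)" "z = (b, g)" "w = (c, h)"
      and cl: "a \<in> carrier R" "f \<in> F" "b \<in> carrier R" "g \<in> F" "c \<in> carrier R" "h \<in> F" "t \<in> F"
      and t: "t \<otimes> (a \<otimes> g) = t \<otimes> (b \<otimes> f)"
      by (cases y, cases z, cases w) (auto simp: fracrel_iff)
    have "t \<otimes> ((c \<otimes> f \<oplus> a \<otimes> h) \<otimes> (h \<otimes> g))
        = t \<otimes> (c \<otimes> f \<otimes> h \<otimes> g) \<oplus> (h \<otimes> h) \<otimes> (t \<otimes> (a \<otimes> g))"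
      using cl by (simp add: m_ac r_distr l_distr)
    also have "\<dots> = t \<otimes> ((c \<otimes> g \<oplus> b \<otimes> h) \<otimes> (h \<otimes> f))"
      unfolding t using cl by (simp add: m_ac r_distr l_distr)
    finally show ?case
      using cl by (auto simp: eq fraction_eq_iff)
  qed
  from UN_equiv_class2[OF fracrel_equiv fracrel_equiv this, of "(a, f)" "(b, g)"] assms
  show ?thesis
    by (simp add: loc_def fraction_def split_def)
qed

lemma one_loc: "\<one>\<^bsub>loc R F\<^esub> = fraction R F \<one> \<one>"
  and zero_loc: "\<zero>\<^bsub>loc R F\<^esub> = fraction R F \<zero> \<one>"
  by (simp_all add: loc_def)

lemma fraction_eqI:
  assumes "a \<in> carrier R" "f \<in> F" "b \<in> carrier R" "g \<in> F" "a \<otimes> g = b \<otimes> f"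
  shows "fraction R F a f = fraction R F b g"
  using assms by (auto simp: fraction_eq_iff intro: bexI[of _ \<one>])

lemma fraction_closed [simp]: "a \<in> carrier R \<Longrightarrow> f \<in> F \<Longrightarrow> fraction R F a f \<in> carrier (loc R F)"
  by (auto simp: carrier_loc)

lemma loc_cases:
  assumes "x \<in> carrier (loc R F)"
  obtains a f where "x = fraction R F a f" "a \<in> carrier R" "f \<in> F"
  using assms by (auto simp: carrier_loc)

lemma cring_loc: "cring (loc R F)"
proof (rule cringI)
  show "abelian_group (loc R F)"
  proof (rule abelian_groupI, goal_cases)
    case (1 x y)
    then show ?case
      by (elim loc_cases) (simp add: add_loc)
  next
    case 2
    show ?case
      by (simp add: zero_loc)
  next
    case (3 x y z)
    then show ?case
      by (elim loc_cases) (simp add: add_loc, rule fraction_eqI; simp add: m_ac a_ac l_distr r_distr)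
  next
    case (4 x y)
    then show ?case
      by (elim loc_cases) (simp add: add_loc, rule fraction_eqI; simp add: m_ac a_ac)
  next
    case (5 x)
    then show ?case
      by (elim loc_cases) (simp add: add_loc zero_loc)
  next
    case (6 x)
    then obtain a f where x: "x = fraction R F a f" and cl: "a \<in> carrier R" "f \<in> F"
      by (rule loc_cases)
    have "fraction R F (\<ominus> a) f \<oplus>\<^bsub>loc R F\<^esub> x = fraction R F (\<ominus> a \<otimes> f \<oplus> a \<otimes> f) (f \<otimes> f)"
      using cl by (simp add: x add_loc)
    also have "\<dots> = \<zero>\<^bsub>loc R F\<^esub>"
      unfolding zero_loc using cl by (intro fraction_eqI) (simp_all add: l_minus l_neg)
    finally show ?case
      using cl by (intro bexI[of _ "fraction R F (\<ominus> a) f"]) simp_all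
  qed
  show "Group.comm_monoid (loc R F)"
  proof (rule Group.comm_monoidI, goal_cases)
    case (1 x y)
    then show ?case
      by (elim loc_cases) (simp add: mult_loc)
  next
    case 2
    show ?case
      by (simp add: one_loc)
  next
    case (3 x y z)
    then show ?case
      by (elim loc_cases) (simp add: mult_loc m_assoc)
  next
    case (4 x)
    then show ?case
      by (elim loc_cases) (simp add: mult_loc one_loc)
  next
    case (5 x y)
    then show ?case
      by (elim loc_cases) (simp add: mult_loc m_comm)
  qed
next
  fix x y z
  assume "x \<in> carrier (loc R F)" "y \<in> carrier (loc R F)" "z \<in> carrier (loc R F)"
  then show "(x \<oplus>\<^bsub>loc R F\<^esub> y) \<otimes>\<^bsub>loc R F\<^esub> z
      = x \<otimes>\<^bsub>loc R F\<^esub> z \<oplus>\<^bsub>loc R F\<^esub> y \<otimes>\<^bsub>loc R F\<^esub> z"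
    by (elim loc_cases) (simp add: add_loc mult_loc, rule fraction_eqI; simp add: m_ac a_ac l_distr r_distr)
qed

end

lemma loc_map_fraction:
  assumes "loc_data R F" "ring_hom_cring R S i" "a \<in> carrier R" "f \<in> F"
  shows "loc_map S F i (fraction R F a f) = fraction S (i ` F) (i a) (i f)"
proof -
  interpret R: loc_data R F by fact
  interpret ring_hom_cring R S i by fact
  interpret F': submonoid "i ` F" S
    by standard (auto simp flip: hom_mult intro: rev_image_eqI[where x = "\<one>\<^bsub>R\<^esub>"])
  interpret S: loc_data S "i ` F" ..
  have "fraction S (i ` F) (i b) (i g) = fraction S (i ` F) (i a) (i f)"
    if "(b, g) \<in> fraction R F a f" for b g
  proof -
    from that obtain t where cl: "b \<in> carrier R" "g \<in> F" "t \<in> F"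
      and t: "t \<otimes>\<^bsub>R\<^esub> (a \<otimes>\<^bsub>R\<^esub> g) = t \<otimes>\<^bsub>R\<^esub> (b \<otimes>\<^bsub>R\<^esub> f)"
      by (auto simp: fraction_def R.fracrel_iff)
    have "i t \<otimes>\<^bsub>S\<^esub> (i a \<otimes>\<^bsub>S\<^esub> i g) = i t \<otimes>\<^bsub>S\<^esub> (i b \<otimes>\<^bsub>S\<^esub> i f)"
      using arg_cong[OF t, of i] cl assms(3,4) by simp
    then show ?thesis
      using cl assms(3,4) by (subst S.fraction_eq_iff) (auto intro!: bexI[of _ t])
  qed
  moreover have "(a, f) \<in> fraction R F a f"
    using assms(3,4) equiv_class_self[OF R.fracrel_equiv, of "(a, f)"]
    by (simp add: fraction_def)
  ultimately show ?thesis
    unfolding loc_map_def by fast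
qed

end

theory Submission
  imports Defs "HOL-Algebra.Subrings"
begin

text \<open>
  Tightness makes the annihilator in \<open>S\<close> of an element of \<open>F\<close> vanish, since it meets \<open>R\<close> trivially,
  and clearing denominators carries integrality, roots of monic polynomials and non-zero ideals back
  and forth between \<open>S\<close> and \<open>F\<^sup>-\<^sup>1S\<close>.

  For uniqueness, let \<open>T\<close> be an aic of \<open>F\<^sup>-\<^sup>1R\<close> and \<open>T0\<close> the integral closure of \<open>R\<close> in \<open>T\<close>.
  Every element of \<open>T\<close> is moved into \<open>T0\<close> by some element of \<open>F\<close>, so that \<open>T = F\<^sup>-\<^sup>1T0\<close>, and \<open>T0\<close> is
  an aic of \<open>R\<close>: roots in \<open>T\<close> of monic polynomials over \<open>T0\<close> are integral over \<open>R\<close>, and a non-zero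
  ideal of \<open>T0\<close> extends to one of \<open>T\<close>, which meets \<open>F\<^sup>-\<^sup>1R\<close>.  Hence \<open>T0\<close> is isomorphic to \<open>S\<close>, and
  localising the isomorphism gives \<open>F\<^sup>-\<^sup>1S \<cong> T\<close>.

  Being ai closed amounts to having a root of every monic polynomial of positive degree.
\<close>

section \<open>Integral elements\<close>

text \<open>
  Polynomial values are defined by recursion because \<open>finsum\<close>, unlike the ring operations, depends
  on the carrier: so they do not change when passing to a subring \<open>R\<lparr>carrier := A\<rparr>\<close>.
\<close>

primrec psum :: "('a, 'm) ring_scheme \<Rightarrow> (nat \<Rightarrow> 'a) \<Rightarrow> 'a \<Rightarrow> nat \<Rightarrow> 'a" where
  "psum R a s 0 = \<zero>\<^bsub>R\<^esub>"
| "psum R a s (Suc n) = psum R a s n \<oplus>\<^bsub>R\<^esub> a n \<otimes>\<^bsub>R\<^esub> s [^]\<^bsub>R\<^esub> n"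

text \<open>These are the values at \<open>s\<close> of the polynomials over \<open>K\<close> of
  degree less than \<open>n\<close>. The strict bound lets \<open>n = 0\<close> stand for the zero
  polynomial.\<close>

primrec below :: "('a, 'm) ring_scheme \<Rightarrow> 'a set \<Rightarrow> 'a \<Rightarrow> nat \<Rightarrow> 'a set" where
  "below R K s 0 = {\<zero>\<^bsub>R\<^esub>}"
| "below R K s (Suc n) = {x \<oplus>\<^bsub>R\<^esub> k \<otimes>\<^bsub>R\<^esub> s [^]\<^bsub>R\<^esub> n | x k. x \<in> below R K s n \<and> k \<in> K}"

text \<open>An integral equation solved for its leading term. When \<open>K\<close> is a subring,
  the sign of the lower coefficients is immaterial.\<close>

definition integral_elt :: "('a, 'm) ring_scheme \<Rightarrow> 'a set \<Rightarrow> 'a \<Rightarrow> bool" where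
  "integral_elt R K s \<longleftrightarrow> s \<in> carrier R \<and> (\<exists>n. s [^]\<^bsub>R\<^esub> n \<in> below R K s n)"

text \<open>Values at \<open>s\<close> of monic polynomials of degree \<open>n\<close>. Being ring
  elements, they can vanish, and \<open>\<zero>\<close> in this set amounts to an integral equation
  for \<open>s\<close>.\<close>

definition monics :: "('a, 'm) ring_scheme \<Rightarrow> 'a set \<Rightarrow> 'a \<Rightarrow> nat \<Rightarrow> 'a set" where
  "monics R K s n = {s [^]\<^bsub>R\<^esub> n \<oplus>\<^bsub>R\<^esub> y | y. y \<in> below R K s n}"

text \<open>The coefficients come from a mere set, because the elimination below takes them from
  \<open>below R K s d\<close>, which bounds degrees and is in general no subring. A generator may
  be added repeatedly.\<close>

inductive_set lin_span :: "('a, 'm) ring_scheme \<Rightarrow> 'a set \<Rightarrow> 'a set \<Rightarrow> 'a set"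
  for R A G where
  lin_span_zero: "\<zero>\<^bsub>R\<^esub> \<in> lin_span R A G"
| lin_span_step: "x \<in> lin_span R A G \<Longrightarrow> a \<in> A \<Longrightarrow> g \<in> G \<Longrightarrow> x \<oplus>\<^bsub>R\<^esub> a \<otimes>\<^bsub>R\<^esub> g \<in> lin_span R A G"

text \<open>Such rings are the certificates of integrality: they consist of integral elements, every
  integral element lies in one, and they can be stacked.\<close>

definition finite_over :: "('a, 'm) ring_scheme \<Rightarrow> 'a set \<Rightarrow> 'a set \<Rightarrow> bool" where
  "finite_over R K A \<longleftrightarrow> subring A R \<and> K \<subseteq> A \<and> (\<exists>G. finite G \<and> G \<subseteq> A \<and> A \<subseteq> lin_span R K G)"

section \<open>Arithmetic of polynomial values of bounded degree\<close>

lemma below_SucI: "y \<in> below R K s n \<Longrightarrow> k \<in> K \<Longrightarrow> y \<oplus>\<^bsub>R\<^esub> k \<otimes>\<^bsub>R\<^esub> s [^]\<^bsub>R\<^esub> n \<in> below R K s (Suc n)"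
  by auto

lemma below_SucE:
  assumes "x \<in> below R K s (Suc n)"
  obtains y k where "x = y \<oplus>\<^bsub>R\<^esub> k \<otimes>\<^bsub>R\<^esub> s [^]\<^bsub>R\<^esub> n" "y \<in> below R K s n" "k \<in> K"
  using assms by auto

lemma below_subring [simp]: "below (R\<lparr>carrier := A\<rparr>) K s n = below R K s n"
  by (induction n) (simp_all add: nat_pow_def)

declare below.simps(2) [simp del]

lemma below_base_mono: "x \<in> below R K s n \<Longrightarrow> K \<subseteq> A \<Longrightarrow> x \<in> below R A s n"
  by (induction n arbitrary: x) (auto elim!: below_SucE intro!: below_SucI)

lemma psum_in_below: "(\<And>k. k < n \<Longrightarrow> a k \<in> K) \<Longrightarrow> psum R a s n \<in> below R K s n"
  by (induction n) (auto intro!: below_SucI)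

lemma psum_cong: "(\<And>k. k < n \<Longrightarrow> a k = b k) \<Longrightarrow> psum R a s n = psum R b s n"
  by (induction n) auto

lemma in_belowE:
  assumes "x \<in> below R K s n"
  obtains a where "\<And>k. k < n \<Longrightarrow> a k \<in> K" "x = psum R a s n"
proof -
  have "\<exists>a. (\<forall>k<n. a k \<in> K) \<and> x = psum R a s n"
    using assms
  proof (induction n arbitrary: x)
    case (Suc n)
    then obtain y k where *: "x = y \<oplus>\<^bsub>R\<^esub> k \<otimes>\<^bsub>R\<^esub> s [^]\<^bsub>R\<^esub> n" "y \<in> below R K s n" "k \<in> K"
      by (auto elim: below_SucE)
    from Suc.IH[OF *(2)] obtain a where a: "\<forall>k<n. a k \<in> K" "y = psum R a s n"
      by blast
    have "psum R (a(n := k)) s n = y"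
      using a by (auto intro: psum_cong)
    then have "x = psum R (a(n := k)) s (Suc n)"
      using * by (simp del: fun_upd_apply add: fun_upd_same)
    then show ?case
      using a * by (intro exI[of _ "a(n := k)"]) (simp del: psum.simps fun_upd_apply add: less_Suc_eq fun_upd_same fun_upd_other)
  qed simp
  then show thesis
    using that by blast
qed

lemma integral_elt_mono: "integral_elt R K s \<Longrightarrow> K \<subseteq> A \<Longrightarrow> integral_elt R A s"
  unfolding integral_elt_def by (metis below_base_mono)

context cring
begin

lemma psum_closed [simp]:
  "(\<And>k. k < n \<Longrightarrow> a k \<in> carrier R) \<Longrightarrow> s \<in> carrier R \<Longrightarrow> psum R a s n \<in> carrier R"
  by (induction n) auto

context
  fixes K s
  assumes K: "subring K R" and s: "s \<in> carrier R"
begin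

lemma K_carrier: "k \<in> K \<Longrightarrow> k \<in> carrier R"
  using subringE(1)[OF K] by blast

lemma below_closed: "x \<in> below R K s n \<Longrightarrow> x \<in> carrier R"
  using s by (induction n arbitrary: x) (auto simp: K_carrier elim!: below_SucE)

lemma below_zero: "\<zero> \<in> below R K s n"
proof (induction n)
  case (Suc n)
  then show ?case
    using s subringE(2)[OF K] below_SucI[of \<zero> R K s n \<zero>] by simp
qed simp

lemma below_add: "x \<in> below R K s n \<Longrightarrow> y \<in> below R K s n \<Longrightarrow> x \<oplus> y \<in> below R K s n"
proof (induction n arbitrary: x y)
  case (Suc n)
  then obtain x' k y' l where *: "x = x' \<oplus> k \<otimes> s [^] n" "x' \<in> below R K s n" "k \<in> K"
    "y = y' \<oplus> l \<otimes> s [^] n" "y' \<in> below R K s n" "l \<in> K"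
    by (auto elim!: below_SucE)
  have "x \<oplus> y = (x' \<oplus> y') \<oplus> (k \<oplus> l) \<otimes> s [^] n"
    using * s by (simp add: below_closed K_carrier l_distr a_ac)
  then show ?case
    using Suc.IH * subringE(7)[OF K] by (auto intro!: below_SucI)
qed simp

lemma below_smult: "k \<in> K \<Longrightarrow> x \<in> below R K s n \<Longrightarrow> k \<otimes> x \<in> below R K s n"
proof (induction n arbitrary: x)
  case 0
  then show ?case by (simp add: K_carrier)
next
  case (Suc n)
  then obtain y l where *: "x = y \<oplus> l \<otimes> s [^] n" "y \<in> below R K s n" "l \<in> K"
    by (auto elim!: below_SucE)
  have "k \<otimes> x = k \<otimes> y \<oplus> (k \<otimes> l) \<otimes> s [^] n"
    using * Suc.prems s by (simp add: below_closed K_carrier r_distr m_assoc)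
  then show ?case
    using Suc * subringE(6)[OF K] by (auto intro!: below_SucI)
qed

lemma below_minus: "x \<in> below R K s n \<Longrightarrow> \<ominus> x \<in> below R K s n"
  using below_smult[of "\<ominus> \<one>" x n] subringE(3,5)[OF K] below_closed[of x n] by (simp add: l_minus)

lemma below_Suc: "x \<in> below R K s n \<Longrightarrow> x \<in> below R K s (Suc n)"
  using subringE(2)[OF K] below_closed[of x n] s below_SucI[of x R K s n \<zero>] by simp

lemma below_mono: "x \<in> below R K s n \<Longrightarrow> n \<le> m \<Longrightarrow> x \<in> below R K s m"
  by (rotate_tac 1, induction m rule: dec_induct) (auto intro: below_Suc)

lemma below_shift: "x \<in> below R K s n \<Longrightarrow> s \<otimes> x \<in> below R K s (Suc n)"
proof (induction n arbitrary: x)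
  case 0
  then show ?case using s below_zero[of 1] by simp
next
  case (Suc n)
  then obtain y l where *: "x = y \<oplus> l \<otimes> s [^] n" "y \<in> below R K s n" "l \<in> K"
    by (auto elim!: below_SucE)
  have "s \<otimes> x = s \<otimes> y \<oplus> l \<otimes> s [^] Suc n"
    using * s by (simp add: below_closed K_carrier r_distr m_ac)
  then show ?case
    using below_SucI[OF Suc.IH[OF *(2)] *(3)] by simp
qed

lemma below_shift_pow: "x \<in> below R K s n \<Longrightarrow> s [^] m \<otimes> x \<in> below R K s (m + n)"
proof (induction m)
  case 0
  then show ?case by (simp add: below_closed)
next
  case (Suc m)
  then show ?case
    using below_shift[of "s [^] m \<otimes> x" "m + n"] s by (simp add: m_ac below_closed)
qed

text \<open>For positive \<open>m\<close> and \<open>n\<close> the sharp bound is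
  \<open>m + n - 1\<close>; the weaker one avoids truncated subtraction and suffices for the
  elimination.\<close>

lemma below_mult: "x \<in> below R K s m \<Longrightarrow> y \<in> below R K s n \<Longrightarrow> x \<otimes> y \<in> below R K s (m + n)"
proof (induction m arbitrary: x)
  case 0
  then show ?case by (simp add: below_closed below_zero)
next
  case (Suc m)
  then obtain z l where *: "x = z \<oplus> l \<otimes> s [^] m" "z \<in> below R K s m" "l \<in> K"
    by (auto elim!: below_SucE)
  have "x \<otimes> y = z \<otimes> y \<oplus> l \<otimes> (s [^] m \<otimes> y)"
    using * Suc.prems s by (simp add: below_closed K_carrier l_distr m_assoc)
  moreover have "\<dots> \<in> below R K s (m + n)"
    using below_add[OF Suc.IH[OF *(2) Suc.prems(2)] below_smult[OF *(3) below_shift_pow[OF Suc.prems(2)]]] .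
  ultimately show ?case
    using below_Suc by simp
qed

text \<open>Of the four products obtained by expanding, only that of the leading terms reaches
  degree \<open>m + n\<close>; the other three lie in \<open>below\<close>.\<close>

lemma monics_mult: "p \<in> monics R K s m \<Longrightarrow> q \<in> monics R K s n \<Longrightarrow> p \<otimes> q \<in> monics R K s (m + n)"
proof -
  assume "p \<in> monics R K s m" "q \<in> monics R K s n"
  then obtain y z where *: "p = s [^] m \<oplus> y" "q = s [^] n \<oplus> z" "y \<in> below R K s m" "z \<in> below R K s n"
    by (auto simp: monics_def)
  have "p \<otimes> q = s [^] (m + n) \<oplus> (s [^] m \<otimes> z \<oplus> s [^] n \<otimes> y \<oplus> y \<otimes> z)"
    using s below_closed *(3,4) unfolding *(1,2)
    by (simp add: l_distr r_distr a_ac m_comm flip: nat_pow_mult)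
  moreover have "s [^] m \<otimes> z \<oplus> s [^] n \<otimes> y \<oplus> y \<otimes> z \<in> below R K s (m + n)"
    using below_shift_pow[OF *(3), of n] below_shift_pow[OF *(4), of m] below_mult[OF *(3,4)] below_add
    by (simp add: add.commute)
  ultimately show ?thesis
    by (auto simp: monics_def)
qed

lemma monics_below: "p \<in> monics R K s m \<Longrightarrow> x \<in> below R K s n \<Longrightarrow> p \<otimes> x \<in> below R K s (m + n)"
proof -
  assume "p \<in> monics R K s m" and x: "x \<in> below R K s n"
  then obtain y where y: "p = s [^] m \<oplus> y" "y \<in> below R K s m"
    by (auto simp: monics_def)
  then have "p \<otimes> x = s [^] m \<otimes> x \<oplus> y \<otimes> x"
    using s x below_closed by (simp add: l_distr)
  then show ?thesis
    using below_add[OF below_shift_pow[OF x] below_mult[OF y(2) x]] by simp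
qed

lemma monics_minus: "p \<in> monics R K s m \<Longrightarrow> x \<in> below R K s m \<Longrightarrow> p \<ominus> x \<in> monics R K s m"
proof -
  assume "p \<in> monics R K s m" and x: "x \<in> below R K s m"
  then obtain y where *: "p = s [^] m \<oplus> y" "y \<in> below R K s m"
    by (auto simp: monics_def)
  then have "p \<ominus> x = s [^] m \<oplus> (y \<oplus> \<ominus> x)"
    using s x below_closed by (simp add: a_minus_def a_ac)
  then show ?thesis
    using * x below_add below_minus by (auto simp: monics_def)
qed

lemma monics_closed: "p \<in> monics R K s m \<Longrightarrow> p \<in> carrier R"
  using s by (auto simp: monics_def below_closed)

lemma integral_eltI_monics: "\<zero> \<in> monics R K s m \<Longrightarrow> integral_elt R K s"
proof -
  assume "\<zero> \<in> monics R K s m"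
  then obtain y where y: "y \<in> below R K s m" "\<zero> = s [^] m \<oplus> y"
    by (auto simp: monics_def)
  then have "s [^] m = \<ominus> y"
    using s below_closed by (metis minus_equality nat_pow_closed minus_minus a_comm)
  then show ?thesis
    using s below_minus[OF y(1)] by (auto simp: integral_elt_def intro!: exI[of _ m])
qed

end

section \<open>Linear spans and elimination of generators\<close>

lemma lin_span_closed: "A \<subseteq> carrier R \<Longrightarrow> G \<subseteq> carrier R \<Longrightarrow> x \<in> lin_span R A G \<Longrightarrow> x \<in> carrier R"
  by (rotate_tac 2, induction rule: lin_span.induct) auto

lemma lin_span_mono: "x \<in> lin_span R A G \<Longrightarrow> A \<subseteq> B \<Longrightarrow> G \<subseteq> H \<Longrightarrow> x \<in> lin_span R B H"
  by (induction rule: lin_span.induct) (auto intro: lin_span.intros)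

lemma lin_span_add:
  assumes "A \<subseteq> carrier R" "G \<subseteq> carrier R" "x \<in> lin_span R A G" "y \<in> lin_span R A G"
  shows "x \<oplus> y \<in> lin_span R A G"
  using assms(4)
proof (induction rule: lin_span.induct)
  case lin_span_zero
  then show ?case using assms lin_span_closed[of A G x] by simp
next
  case (lin_span_step y a g)
  then have "x \<oplus> (y \<oplus> a \<otimes> g) = (x \<oplus> y) \<oplus> a \<otimes> g"
    using assms lin_span_closed[of A G] by (auto simp: a_assoc subset_iff)
  then show ?case
    using lin_span_step by (auto intro: lin_span.intros)
qed

text \<open>The coefficient set may change from \<open>A\<close> to \<open>B\<close>, which records
  the growth of degrees when a whole row is multiplied by \<open>q\<close>.\<close>

lemma lin_span_scale:
  assumes "A \<subseteq> carrier R" "G \<subseteq> carrier R" "q \<in> carrier R" "x \<in> lin_span R A G"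
    and "\<And>a. a \<in> A \<Longrightarrow> q \<otimes> a \<in> B"
  shows "q \<otimes> x \<in> lin_span R B G"
  using assms(4)
proof (induction rule: lin_span.induct)
  case lin_span_zero
  then show ?case using assms by (simp add: lin_span.lin_span_zero)
next
  case (lin_span_step y a g)
  then have "q \<otimes> (y \<oplus> a \<otimes> g) = q \<otimes> y \<oplus> (q \<otimes> a) \<otimes> g"
    using assms lin_span_closed[of A G] by (auto simp: r_distr m_assoc subset_iff)
  then show ?case
    using lin_span_step assms by (auto intro: lin_span.intros)
qed

text \<open>All occurrences of \<open>g\<close> are gathered into one coefficient, which works
  because \<open>A\<close> is closed under addition. This isolates the column that the elimination
  removes.\<close>

lemma lin_span_insertD:
  assumes "A \<subseteq> carrier R" "G \<subseteq> carrier R" "g \<in> carrier R" "\<zero> \<in> A"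
    and add: "\<And>a b. a \<in> A \<Longrightarrow> b \<in> A \<Longrightarrow> a \<oplus> b \<in> A"
    and "x \<in> lin_span R A (insert g G)"
  shows "\<exists>c \<in> A. \<exists>y \<in> lin_span R A G. x = c \<otimes> g \<oplus> y"
  using assms(6)
proof (induction rule: lin_span.induct)
  case lin_span_zero
  then show ?case using assms lin_span.lin_span_zero by (auto intro!: bexI[of _ "\<zero>"])
next
  case (lin_span_step x a h)
  then obtain c y where cy: "c \<in> A" "y \<in> lin_span R A G" "x = c \<otimes> g \<oplus> y"
    by blast
  then have cl: "c \<in> carrier R" "y \<in> carrier R" "a \<in> carrier R" "h \<in> carrier R" "g \<in> carrier R"
    using lin_span_step assms lin_span_closed[of A G y] by auto
  show ?case
  proof (cases "h = g")
    case True
    have "x \<oplus> a \<otimes> h = (c \<oplus> a) \<otimes> g \<oplus> y"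
      using cy cl True by (simp add: l_distr a_ac)
    then show ?thesis using cy lin_span_step add by blast
  next
    case False
    have "x \<oplus> a \<otimes> h = c \<otimes> g \<oplus> (y \<oplus> a \<otimes> h)"
      using cy cl by (simp add: a_ac)
    moreover have "y \<oplus> a \<otimes> h \<in> lin_span R A G"
      using False cy lin_span_step by (auto intro: lin_span.intros)
    ultimately show ?thesis using cy by blast
  qed
qed

text \<open>
  Division-free Gaussian elimination replaces the determinant trick: eliminating one generator
  doubles the degrees, and keeps the diagonal entries monic and the other ones of smaller degree.
\<close>

lemma integral_elt_elimination:
  assumes K: "subring K R" and s: "s \<in> carrier R" and "finite G" "G \<subseteq> carrier R"
    and "\<And>g. g \<in> insert \<one> G \<Longrightarrow> \<exists>p \<in> monics R K s d. p \<otimes> g \<in> lin_span R (below R K s d) (insert \<one> G)"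
  shows "integral_elt R K s"
  using assms(3-)
proof (induction G arbitrary: d rule: finite_induct)
  case empty
  note cl = below_closed[OF K s] monics_closed[OF K s]
  \<comment> \<open>With \<open>\<one>\<close> as the only generator left, the relation reads
    \<open>p = c\<close>, so the monic value \<open>p - c\<close> vanishes. Keeping
    \<open>\<one>\<close> among the generators is what turns a relation on generators into an
    equation in the ring.\<close>
  obtain p where p: "p \<in> monics R K s d" "p \<otimes> \<one> \<in> lin_span R (below R K s d) {\<one>}"
    using empty by auto
  obtain c y where c: "c \<in> below R K s d" "y \<in> lin_span R (below R K s d) {}" "p \<otimes> \<one> = c \<otimes> \<one> \<oplus> y"
    using lin_span_insertD[OF _ _ _ below_zero[OF K s] below_add[OF K s] p(2)] cl(1) by auto
  have "y = \<zero>"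
    using c(2) by (cases rule: lin_span.cases) auto
  then have "p \<ominus> c = \<zero>"
    using c p cl by auto
  then show ?case
    using monics_minus[OF K s p(1) c(1)] integral_eltI_monics[OF K s] by simp
next
  case (insert g G)
  note cl = below_closed[OF K s] monics_closed[OF K s]
  let ?B = "below R K s"
  let ?H = "insert \<one> G"
  have H: "?H \<subseteq> carrier R" "g \<in> carrier R" and B: "?B n \<subseteq> carrier R" for n
    using insert.prems cl by auto
  have eq: "insert \<one> (insert g G) = insert g ?H"
    by blast
  note hyp = insert.prems(2)[unfolded eq]
  have split: "\<exists>c \<in> ?B d. \<exists>y \<in> lin_span R (?B d) ?H. x = c \<otimes> g \<oplus> y"
    if "x \<in> lin_span R (?B d) (insert g ?H)" for x
    by (rule lin_span_insertD[OF B H below_zero[OF K s] below_add[OF K s] that])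
  obtain p where p: "p \<in> monics R K s d" "p \<otimes> g \<in> lin_span R (?B d) (insert g ?H)"
    using hyp by blast
  from split[OF p(2)] obtain c y where c: "c \<in> ?B d" "y \<in> lin_span R (?B d) ?H" "p \<otimes> g = c \<otimes> g \<oplus> y"
    by blast
  \<comment> \<open>The pivot: the diagonal coefficient \<open>c\<close> moves to the left, where it
    does not disturb the leading term of \<open>p\<close>, and \<open>q g = y\<close> has no
    \<open>g\<close> on the right.\<close>
  define q where "q = p \<ominus> c"
  have q: "q \<in> monics R K s d"
    unfolding q_def using monics_minus[OF K s p(1) c(1)] .
  have ycl: "y \<in> carrier R"
    using lin_span_closed[OF B H(1) c(2)] .
  have qg: "q \<otimes> g = y"
  proof -
    have "q \<otimes> g = p \<otimes> g \<ominus> c \<otimes> g"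
      unfolding q_def using p(1) c(1) H cl by (simp add: a_minus_def l_distr l_minus)
    also have "\<dots> = y"
      unfolding c(3) using c(1) H cl(1)[OF c(1)] ycl by (simp add: a_minus_def a_ac r_neg2 r_neg)
    finally show ?thesis .
  qed
  show ?case
  proof (rule insert.IH[of "d + d"])
    show "G \<subseteq> carrier R" using insert.prems by simp
    fix h assume h: "h \<in> insert \<one> G"
    obtain r where r: "r \<in> monics R K s d" "r \<otimes> h \<in> lin_span R (?B d) (insert g ?H)"
      using hyp h by blast
    from split[OF r(2)] obtain e z where e: "e \<in> ?B d" "z \<in> lin_span R (?B d) ?H" "r \<otimes> h = e \<otimes> g \<oplus> z"
      by blast
    have clh: "h \<in> carrier R" "q \<in> carrier R" "r \<in> carrier R" "e \<in> carrier R" "z \<in> carrier R"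
      using h H q r e cl lin_span_closed[OF B H(1)] by auto
    \<comment> \<open>The row of \<open>h\<close> is multiplied by \<open>q\<close> where ordinary
      elimination would divide by it; then \<open>q g\<close> can be replaced by \<open>y\<close>,
      and \<open>g\<close> is gone.\<close>
    have "(q \<otimes> r) \<otimes> h = e \<otimes> (q \<otimes> g) \<oplus> q \<otimes> z"
    proof -
      have "(q \<otimes> r) \<otimes> h = q \<otimes> (e \<otimes> g \<oplus> z)"
        using clh by (simp add: m_assoc flip: e(3))
      also have "\<dots> = e \<otimes> (q \<otimes> g) \<oplus> q \<otimes> z"
        using clh H(2) by (simp add: r_distr m_lcomm)
      finally show ?thesis .
    qed
    moreover have "e \<otimes> y \<in> lin_span R (?B (d + d)) ?H"
      using lin_span_scale[OF B H(1) clh(4) c(2) below_mult[OF K s e(1)]] by blast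
    moreover have "q \<otimes> z \<in> lin_span R (?B (d + d)) ?H"
      using lin_span_scale[OF B H(1) clh(2) e(2) monics_below[OF K s q]] by blast
    ultimately have "(q \<otimes> r) \<otimes> h \<in> lin_span R (?B (d + d)) ?H"
      unfolding qg using lin_span_add[OF B H(1)] by simp
    then show "\<exists>p \<in> monics R K s (d + d). p \<otimes> h \<in> lin_span R (?B (d + d)) ?H"
      using monics_mult[OF K s q r(1)] by blast
  qed
qed

section \<open>Finite ring extensions and transitivity of integrality\<close>

text \<open>Multiplication by \<open>s\<close> maps \<open>A\<close> into itself, hence each
  generator to a \<open>K\<close>-combination of the generators. This is the input of the
  elimination with \<open>d = 1\<close>: \<open>s\<close> is monic of degree 1, and the elements of
  \<open>K\<close> have degree less than 1.\<close>

lemma finite_over_integral: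
  assumes K: "subring K R" and A: "finite_over R K A" and s: "s \<in> A"
  shows "integral_elt R K s"
proof -
  obtain G where sub: "subring A R" and KA: "K \<subseteq> A" and G: "finite G" "G \<subseteq> A" "A \<subseteq> lin_span R K G"
    using A unfolding finite_over_def by blast
  have scl: "s \<in> carrier R" and Gcl: "G \<subseteq> carrier R"
    using subringE(1)[OF sub] s G by auto
  have Kcl: "K \<subseteq> carrier R"
    using subringE(1)[OF K] .
  have "K \<subseteq> below R K s 1"
    using Kcl below_SucI[of \<zero> R K s 0] by (auto simp: subset_iff)
  moreover have "s \<in> monics R K s 1"
    using scl below_zero[OF K scl, of 1] by (auto simp: monics_def intro!: exI[of _ "\<zero>"])
  moreover have "s \<otimes> g \<in> lin_span R K G" if "g \<in> insert \<one> G" for g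
    using that G s subringE(3,6)[OF sub] by blast
  ultimately show ?thesis
    by (intro integral_elt_elimination[OF K scl G(1) Gcl, of 1]) (blast intro: lin_span_mono)
qed

lemma finite_over_refl:
  assumes "subring K R" shows "finite_over R K K"
proof -
  have "k \<in> lin_span R K {\<one>}" if "k \<in> K" for k
    using lin_span_step[OF lin_span_zero that, of \<one> "{\<one>}" R] subringE(1)[OF assms] that by auto
  then show ?thesis
    using assms subringE(3)[OF assms] unfolding finite_over_def by (intro conjI exI[of _ "{\<one>}"]) auto
qed

text \<open>The products of the generators of the two steps generate \<open>B\<close> over
  \<open>K\<close>.\<close>

lemma finite_over_trans:
  assumes K: "subring K R" and A: "finite_over R K A" and B: "finite_over R A B"
  shows "finite_over R K B"
proof -
  obtain G where A: "subring A R" "K \<subseteq> A" and G: "finite G" "G \<subseteq> A" "A \<subseteq> lin_span R K G"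
    using A unfolding finite_over_def by blast
  obtain H where B: "subring B R" "A \<subseteq> B" and H: "finite H" "H \<subseteq> B" "B \<subseteq> lin_span R A H"
    using B unfolding finite_over_def by blast
  let ?P = "(\<lambda>(g, h). g \<otimes> h) ` (G \<times> H)"
  have cl: "K \<subseteq> carrier R" "A \<subseteq> carrier R" "B \<subseteq> carrier R"
    using subringE(1) K A B by auto
  have P: "?P \<subseteq> B"
    using G H B(2) subringE(6)[OF B(1)] by (auto simp: subset_iff)
  have Pcl: "?P \<subseteq> carrier R" and Gcl: "G \<subseteq> carrier R"
    using P G cl by auto
  have mult: "a \<otimes> h \<in> lin_span R K ?P" if "a \<in> lin_span R K G" "h \<in> H" for a h
    using that(1)
  proof (induction rule: lin_span.induct)
    case lin_span_zero
    then show ?case using that H cl lin_span.lin_span_zero by (auto simp: subset_iff)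
  next
    case (lin_span_step x k g)
    have "(x \<oplus> k \<otimes> g) \<otimes> h = x \<otimes> h \<oplus> k \<otimes> (g \<otimes> h)"
      using lin_span_step that H G cl lin_span_closed[OF cl(1) Gcl, of x]
      by (auto simp: subset_iff l_distr m_assoc)
    moreover have "g \<otimes> h \<in> ?P" using lin_span_step that by force
    ultimately show ?case
      using lin_span.lin_span_step[OF lin_span_step.IH lin_span_step.hyps(2)] by metis
  qed
  have "x \<in> lin_span R K ?P" if "x \<in> lin_span R A H" for x
    using that
  proof (induction rule: lin_span.induct)
    case lin_span_zero
    then show ?case by (rule lin_span.lin_span_zero)
  next
    case (lin_span_step x a h)
    then show ?case
      using mult G by (intro lin_span_add[OF cl(1) Pcl]) auto
  qed
  then show ?thesis
    unfolding finite_over_def using A B G H P by (intro conjI exI[of _ ?P]) auto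
qed

text \<open>The ring is \<open>K[s]\<close>: an integral equation of degree \<open>n\<close> reduces
  all powers of \<open>s\<close> to those below \<open>n\<close>, so \<open>below R K s n\<close> is
  already closed under multiplication.\<close>

lemma integral_elt_finite_over:
  assumes K: "subring K R" and s: "integral_elt R K s"
  obtains A where "finite_over R K A" "s \<in> A"
proof -
  obtain n where n: "s [^] n \<in> below R K s n" and scl: "s \<in> carrier R"
    using s unfolding integral_elt_def by blast
  note cl = below_closed[OF K scl] K_carrier[OF K]
  define A where "A = below R K s n"
  have collapse: "below R K s m \<subseteq> A" for m
  proof (induction m)
    case 0
    then show ?case using below_zero[OF K scl] by (simp add: A_def)
  next
    case (Suc m)
    have "s [^] m \<in> A"
    proof (cases "m = 0")
      case True
      show ?thesis
      proof (cases n)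
        case 0
        then show ?thesis using n True by (simp add: A_def)
      next
        case (Suc n')
        have "\<one> \<in> below R K s 1"
          using subringE(3)[OF K] below_SucI[of \<zero> R K s 0 \<one>] by simp
        then show ?thesis
          using True below_mono[OF K scl _, of \<one> 1 n] Suc by (simp add: A_def)
      qed
    next
      case False
      have "s [^] k \<in> A" if "k \<ge> n" for k
        using that
      proof (induction k rule: dec_induct)
        case base
        then show ?case using n by (simp add: A_def)
      next
        case (step k)
        \<comment> \<open>Shifting the expression for \<open>s^k\<close> by one power overflows only
          in the term \<open>l s^n\<close>, which the integral equation brings back into
          \<open>A\<close>.\<close>
        obtain x l where x: "s \<otimes> s [^] k = x \<oplus> l \<otimes> s [^] n" "x \<in> A" "l \<in> K"
          using below_SucE[OF below_shift[OF K scl step.IH[unfolded A_def]]] by (auto simp: A_def)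
        moreover have "l \<otimes> s [^] n \<in> A"
          unfolding A_def using below_smult[OF K scl x(3) n] .
        ultimately show ?case
          using scl below_add[OF K scl] by (simp add: A_def m_comm)
      qed
      moreover have "s [^] m \<in> A" if "m < n"
      proof -
        have "s [^] m \<in> below R K s (Suc m)"
          using below_SucI[OF below_zero[OF K scl, of m] subringE(3)[OF K]] scl by simp
        then show ?thesis
          unfolding A_def using below_mono[OF K scl] that by auto
      qed
      ultimately show ?thesis by force
    qed
    then show ?case
      using Suc below_add[OF K scl] below_smult[OF K scl] by (auto simp: A_def elim!: below_SucE)
  qed
  have KA: "K \<subseteq> A"
    using collapse[of 1] cl(2) below_SucI[of \<zero> R K s 0] by fastforce
  have pow: "s [^] m \<in> A" for m :: nat
  proof -
    have "s [^] m \<in> below R K s (Suc m)"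
      using below_SucI[OF below_zero[OF K scl, of m] subringE(3)[OF K]] scl by simp
    then show ?thesis using collapse by blast
  qed
  have "subring A R"
  proof (rule subringI)
    show "A \<subseteq> carrier R" using cl by (auto simp: A_def)
    show "\<one> \<in> A" using KA subringE(3)[OF K] by blast
    show "\<ominus> h \<in> A" if "h \<in> A" for h
      using that below_minus[OF K scl] by (simp add: A_def)
    show "h \<otimes> k \<in> A" if "h \<in> A" "k \<in> A" for h k
      using that below_mult[OF K scl] collapse unfolding A_def by blast
    show "h \<oplus> k \<in> A" if "h \<in> A" "k \<in> A" for h k
      using that below_add[OF K scl] by (simp add: A_def)
  qed
  moreover have "below R K s m \<subseteq> lin_span R K ((\<lambda>k. s [^] k) ` {..<m})" for m
  proof (induction m)
    case 0
    then show ?case by (auto intro: lin_span.intros)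
  next
    case (Suc m)
    have "x \<in> lin_span R K ((\<lambda>k. s [^] k) ` {..<Suc m})" if "x \<in> below R K s m" for x
      using Suc that by (auto intro: lin_span_mono)
    then show ?case
      by (auto intro!: lin_span_step elim!: below_SucE)
  qed
  ultimately have "finite_over R K A"
    unfolding finite_over_def using KA pow
    by (intro conjI exI[of _ "(\<lambda>k. s [^] k) ` {..<n}"]) (auto simp: A_def)
  moreover have "s \<in> A" using pow[of 1] scl by simp
  ultimately show thesis using that by blast
qed

text \<open>The elements are adjoined one at a time; each remains integral over the ring reached so
  far, because that ring contains \<open>K\<close>.\<close>

lemma integral_elts_finite_over:
  assumes K: "subring K R" and "\<And>k. k < (n::nat) \<Longrightarrow> integral_elt R K (a k)"
  shows "\<exists>A. finite_over R K A \<and> (\<forall>k<n. a k \<in> A)"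
  using assms(2)
proof (induction n)
  case 0
  then show ?case using finite_over_refl[OF K] by auto
next
  case (Suc n)
  then obtain A where A: "finite_over R K A" "\<forall>k<n. a k \<in> A"
    by auto
  then have sub: "subring A R" "K \<subseteq> A"
    by (auto simp: finite_over_def)
  have "integral_elt R A (a n)"
    using integral_elt_mono[OF Suc.prems[of n] sub(2)] by simp
  from integral_elt_finite_over[OF sub(1) this]
  obtain B where B: "finite_over R A B" "a n \<in> B" .
  then have "A \<subseteq> B" by (simp add: finite_over_def)
  then show ?case
    using A B finite_over_trans[OF K] by (intro exI[of _ B]) (auto simp: less_Suc_eq)
qed

text \<open>The coefficients lie in one ring \<open>A\<close> finite over \<open>K\<close>, and
  \<open>s\<close>, being integral over \<open>A\<close>, lies in a ring \<open>B\<close> finite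
  over \<open>A\<close>. Then \<open>B\<close> is finite over \<open>K\<close>, which makes
  \<open>s\<close> integral over \<open>K\<close>.\<close>

lemma integral_elt_trans:
  assumes K: "subring K R" and s: "s \<in> carrier R"
    and "\<And>k. k < n \<Longrightarrow> integral_elt R K (a k)" and "s [^] n \<oplus> psum R a s n = \<zero>"
  shows "integral_elt R K s"
proof -
  obtain A where A: "finite_over R K A" "\<forall>k<n. a k \<in> A"
    using integral_elts_finite_over[OF K, of n a] assms(3) by auto
  then have sub: "subring A R"
    by (simp add: finite_over_def)
  have "\<zero> \<in> monics R A s n"
    using psum_in_below[of n a A R s] A(2) assms(4) by (auto simp: monics_def intro!: exI[of _ "psum R a s n"])
  then have "integral_elt R A s"
    by (rule integral_eltI_monics[OF sub s])
  from integral_elt_finite_over[OF sub this]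
  obtain B where B: "finite_over R A B" "s \<in> B" .
  then show ?thesis
    using finite_over_integral[OF K finite_over_trans[OF K A(1) B(1)]] by blast
qed

lemma integral_elt_base:
  assumes "subring K R" "k \<in> K" shows "integral_elt R K k"
  using finite_over_integral[OF assms(1) finite_over_refl[OF assms(1)] assms(2)] .

text \<open>Two integral elements lie in a common ring finite over \<open>K\<close>, which also
  contains their sum and product.\<close>

lemma integral_closure_subring:
  assumes K: "subring K R"
  shows "subring {s \<in> carrier R. integral_elt R K s} R"
proof -
  have pair: "\<exists>A. subring A R \<and> finite_over R K A \<and> x \<in> A \<and> y \<in> A"
    if "integral_elt R K x" "integral_elt R K y" for x y
  proof -
    \<comment> \<open>The pair is packed as a family indexed by 0 and 1.\<close>
    have "integral_elt R K (if k = (0::nat) then x else y)" for k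
      using that by simp
    then obtain A where A: "finite_over R K A" "\<forall>k<2::nat. (if k = 0 then x else y) \<in> A"
      using integral_elts_finite_over[OF K, of 2 "\<lambda>k. if k = 0 then x else y"] by auto
    from A(1) A(2)[THEN spec, of 0] A(2)[THEN spec, of 1] show ?thesis
      by (intro exI[of _ A]) (simp add: finite_over_def)
  qed
  show ?thesis
  proof (rule subringI)
    show "\<one> \<in> {s \<in> carrier R. integral_elt R K s}"
      using integral_elt_base[OF K] subringE(3)[OF K] by simp
    fix h assume h: "h \<in> {s \<in> carrier R. integral_elt R K s}"
    then obtain A where A: "subring A R" "finite_over R K A" "h \<in> A"
      using pair[of h h] by auto
    from finite_over_integral[OF K A(2) subringE(5)[OF A(1,3)]] h
    show "\<ominus> h \<in> {s \<in> carrier R. integral_elt R K s}"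
      by simp
    fix k assume k: "k \<in> {s \<in> carrier R. integral_elt R K s}"
    then obtain A where A: "subring A R" "finite_over R K A" "h \<in> A" "k \<in> A"
      using h pair[of h k] by auto
    from finite_over_integral[OF K A(2) subringE(6)[OF A(1,3,4)]] h k
    show "h \<otimes> k \<in> {s \<in> carrier R. integral_elt R K s}"
      by simp
    from finite_over_integral[OF K A(2) subringE(7)[OF A(1,3,4)]] h k
    show "h \<oplus> k \<in> {s \<in> carrier R. integral_elt R K s}"
      by simp
  qed auto
qed

end

section \<open>Roots of monic polynomials\<close>

text \<open>The monic polynomial is given by its lower coefficients, of which only those below
  \<open>n\<close> matter. The case \<open>n = 0\<close> is left out, since the constant polynomial
  1 has no root in a nonzero ring.\<close>

definition rooted :: "('a, 'm) ring_scheme \<Rightarrow> bool" where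
  "rooted S \<longleftrightarrow> (\<forall>n>0. \<forall>a. (\<forall>k<n. a k \<in> carrier S) \<longrightarrow>
     (\<exists>s \<in> carrier S. s [^]\<^bsub>S\<^esub> (n::nat) \<oplus>\<^bsub>S\<^esub> psum S a s n = \<zero>\<^bsub>S\<^esub>))"

section \<open>From polynomials in \<open>UP\<close> to recursive sums\<close>

lemma (in cring) UP_cring_UP: "UP_cring R"
  by (rule UP_cring.intro, rule cring_axioms)

lemma (in cring) monic_exists:
  assumes "\<one> \<noteq> \<zero>" and a: "\<And>k. k < n \<Longrightarrow> a k \<in> carrier R"
  shows "\<exists>p. monic R p \<and> deg R p = n \<and> (\<forall>k<n. coeff (UP R) p k = a k)"
proof -
  interpret U: UP_cring R "UP R" by (rule UP_cring_UP) simp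
  \<comment> \<open>Elements of \<open>UP R\<close> are coefficient functions that vanish from some
    index on, so the polynomial can be written down directly. As \<open>\<one>\<close> differs from
    \<open>\<zero>\<close>, its degree is exactly \<open>n\<close>.\<close>
  define p where "p = (\<lambda>k. if k < n then a k else if k = n then \<one> else \<zero>)"
  have p: "p \<in> carrier (UP R)"
    using a by (auto simp: UP_def p_def up_def bound_def Pi_def)
  then have c: "coeff (UP R) p = p"
    by (simp add: UP_def)
  have d: "deg R p = n"
    using assms(1) p by (intro antisym U.deg_aboveI U.deg_belowI) (simp_all add: c, simp_all add: p_def)
  show ?thesis
    using p c d by (intro exI[of _ p]) (simp add: monic_def p_def)
qed

lemma finsum_eq_psum:
  assumes "cring S" "s \<in> carrier S" "\<And>k. k < n \<Longrightarrow> a k \<in> carrier S"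
  shows "(\<Oplus>\<^bsub>S\<^esub>k \<in> {..<n}. a k \<otimes>\<^bsub>S\<^esub> s [^]\<^bsub>S\<^esub> k) = psum S a s n"
proof -
  interpret cring S by fact
  show ?thesis
    using assms(3)
  proof (induction n)
    case (Suc n)
    then have "(\<Oplus>\<^bsub>S\<^esub>k \<in> insert n {..<n}. a k \<otimes>\<^bsub>S\<^esub> s [^]\<^bsub>S\<^esub> k)
        = a n \<otimes>\<^bsub>S\<^esub> s [^]\<^bsub>S\<^esub> n \<oplus>\<^bsub>S\<^esub> (\<Oplus>\<^bsub>S\<^esub>k \<in> {..<n}. a k \<otimes>\<^bsub>S\<^esub> s [^]\<^bsub>S\<^esub> k)"
      using assms(2) by (intro finsum_insert) auto
    then show ?case
      using Suc assms(2) by (simp add: lessThan_Suc a_comm)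
  qed simp
qed

text \<open>The term of index \<open>deg R p\<close> is split off; its coefficient is 1, and
  \<open>i\<close> maps 1 to 1.\<close>

lemma eval_monic:
  assumes "ring_hom_cring R S i" "s \<in> carrier S" "monic R p"
  shows "eval R S i s p = s [^]\<^bsub>S\<^esub> deg R p \<oplus>\<^bsub>S\<^esub> psum S (\<lambda>k. i (coeff (UP R) p k)) s (deg R p)"
proof -
  interpret ring_hom_cring R S i by fact
  interpret U: UP_cring R "UP R" by (rule R.UP_cring_UP) simp
  let ?a = "\<lambda>k. i (coeff (UP R) p k)"
  have p: "p \<in> carrier (UP R)" "coeff (UP R) p (deg R p) = \<one>\<^bsub>R\<^esub>"
    using assms(3) by (auto simp: monic_def)
  have "eval R S i s p = (\<Oplus>\<^bsub>S\<^esub>k \<in> {..<Suc (deg R p)}. ?a k \<otimes>\<^bsub>S\<^esub> s [^]\<^bsub>S\<^esub> k)"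
    using p by (simp add: eval_def lessThan_Suc_atMost)
  also have "\<dots> = psum S ?a s (Suc (deg R p))"
    using finsum_eq_psum[OF S.is_cring assms(2), of "Suc (deg R p)" ?a] p by simp
  finally show ?thesis
    using p assms(2) S.psum_closed[of "deg R p" ?a s] by (simp add: S.a_comm)
qed

lemma (in ring_hom_cring) carrier_image_subring: "subring (h ` carrier R) S"
  by (rule ring.img_is_subring[OF R.carrier_is_subring])

lemma (in ring_hom_cring) integral_over_iff:
  "integral_over R S h \<longleftrightarrow> (\<forall>s \<in> carrier S. integral_elt S (h ` carrier R) s)"
proof -
  note K = carrier_image_subring
  have "(\<exists>p. monic R p \<and> eval R S h s p = \<zero>\<^bsub>S\<^esub>) \<longleftrightarrow> integral_elt S (h ` carrier R) s"
    if s: "s \<in> carrier S" for s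
  proof
    assume "\<exists>p. monic R p \<and> eval R S h s p = \<zero>\<^bsub>S\<^esub>"
    then obtain p where p: "monic R p" "eval R S h s p = \<zero>\<^bsub>S\<^esub>"
      by blast
    interpret U: UP_cring R "UP R" by (rule R.UP_cring_UP) simp
    let ?a = "\<lambda>k. h (coeff (UP R) p k)"
    have "psum S ?a s (deg R p) \<in> below S (h ` carrier R) s (deg R p)"
      using p(1) by (intro psum_in_below) (simp add: monic_def)
    then have "\<zero>\<^bsub>S\<^esub> \<in> monics S (h ` carrier R) s (deg R p)"
      using eval_monic[OF ring_hom_cring_axioms s p(1)] p(2) by (auto simp: monics_def intro!: exI[of _ "psum S ?a s (deg R p)"])
    then show "integral_elt S (h ` carrier R) s"
      by (rule S.integral_eltI_monics[OF K s])
  next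
    assume "integral_elt S (h ` carrier R) s"
    then obtain n where "s [^]\<^bsub>S\<^esub> n \<in> below S (h ` carrier R) s n"
      by (auto simp: integral_elt_def)
    then have "\<ominus>\<^bsub>S\<^esub> (s [^]\<^bsub>S\<^esub> n) \<in> below S (h ` carrier R) s n"
      by (rule S.below_minus[OF K s])
    then obtain a where a: "\<And>k. k < n \<Longrightarrow> a k \<in> h ` carrier R" "\<ominus>\<^bsub>S\<^esub> (s [^]\<^bsub>S\<^esub> n) = psum S a s n"
      by (rule in_belowE) blast
    show "\<exists>p. monic R p \<and> eval R S h s p = \<zero>\<^bsub>S\<^esub>"
    proof (cases "\<one> = \<zero>")
      \<comment> \<open>In the zero ring no polynomial of positive degree exists. But then
        \<open>S\<close> is zero as well, and the polynomial 1, which is monic there, evaluates to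
        the only element.\<close>
      case True
      then have "\<one>\<^bsub>S\<^esub> = \<zero>\<^bsub>S\<^esub>" using hom_one hom_zero by metis
      then have triv: "carrier S = {\<zero>\<^bsub>S\<^esub>}"
        using S.one_zeroD by blast
      interpret U: UP_cring R "UP R" by (rule R.UP_cring_UP) simp
      interpret E: UP_pre_univ_prop R S h "UP R" by unfold_locales
      have "monic R \<one>\<^bsub>UP R\<^esub>"
        using R.one_zeroD[OF True] U.deg_one by (auto simp: monic_def)
      moreover have "eval R S h s \<one>\<^bsub>UP R\<^esub> \<in> carrier S"
        using E.eval_ring_hom[OF s] by (auto simp: ring_hom_def)
      ultimately show ?thesis using triv by auto
    next
      case False
      \<comment> \<open>The coefficients lie in the image of \<open>h\<close> and are lifted to
        \<open>R\<close>. Any preimages will do, because the equation is evaluated in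
        \<open>S\<close>.\<close>
      define b where "b = (\<lambda>k. inv_into (carrier R) h (a k))"
      have b: "b k \<in> carrier R" "h (b k) = a k" if "k < n" for k
        using a(1)[OF that] by (auto simp: b_def inv_into_into f_inv_into_f)
      obtain p where p: "monic R p" "deg R p = n" "\<forall>k<n. coeff (UP R) p k = b k"
        using R.monic_exists[OF False, of n b] b(1) by auto
      have psum: "psum S (\<lambda>k. h (coeff (UP R) p k)) s n = \<ominus>\<^bsub>S\<^esub> (s [^]\<^bsub>S\<^esub> n)"
        unfolding a(2) using p b by (intro psum_cong) simp
      have "eval R S h s p = \<zero>\<^bsub>S\<^esub>"
        using eval_monic[OF ring_hom_cring_axioms s p(1)] p(2) s by (simp add: psum S.r_neg)
      then show ?thesis using p by blast
    qed
  qed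
  then show ?thesis by (auto simp: integral_over_def)
qed

section \<open>Factorisation into linear factors versus existence of roots\<close>

lemma (in cring) monic_linear_closed [simp]: "a \<in> carrier R \<Longrightarrow> monic_linear R a \<in> carrier (UP R)"
proof -
  assume a: "a \<in> carrier R"
  interpret U: UP_cring R "UP R" by (rule UP_cring_UP) simp
  show ?thesis using a by (simp add: monic_linear_def)
qed

text \<open>A factorisation of a monic polynomial of positive degree has at least one linear factor,
  and evaluation at the root of that factor kills the product.\<close>

lemma (in cring) ai_closed_imp_rooted:
  assumes "ai_closed R"
  shows "rooted R"
  unfolding rooted_def
proof (intro allI impI)
  fix n :: nat and a assume n: "n > 0" and a: "\<forall>k<n. a k \<in> carrier R"
  interpret U: UP_cring R "UP R" by (rule UP_cring_UP) simp
  interpret id: ring_hom_cring R R id by unfold_locales (simp add: ring_hom_def)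
  show "\<exists>s \<in> carrier R. s [^] n \<oplus> psum R a s n = \<zero>"
  proof (cases "\<one> = \<zero>")
    \<comment> \<open>The zero ring has no polynomial of degree \<open>n\<close>, but its only
      element satisfies every equation.\<close>
    case True
    then have "carrier R = {\<zero>}" by (rule one_zeroD)
    moreover have "\<zero> [^] n \<oplus> psum R a \<zero> n \<in> carrier R"
      using a by simp
    ultimately show ?thesis by blast
  next
    case False
    obtain p where p: "monic R p" "deg R p = n" "\<forall>k<n. coeff (UP R) p k = a k"
      using monic_exists[OF False, of n a] a by auto
    obtain m :: nat and b where b: "b \<in> {..<m} \<rightarrow> carrier R"
        "p = (\<Otimes>\<^bsub>UP R\<^esub> k \<in> {..<m}. monic_linear R (b k))"
      using assms p(1) unfolding ai_closed_def by blast
    have "m \<noteq> 0"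
    proof
      assume "m = 0"
      then have "p = \<one>\<^bsub>UP R\<^esub>" using b by simp
      then show False using p(2) n U.deg_one by simp
    qed
    then obtain m' where m: "m = Suc m'" by (cases m) auto
    have bm: "b m' \<in> carrier R" using b m by auto
    have cl: "(\<lambda>k. monic_linear R (b k)) \<in> {..<m'} \<rightarrow> carrier (UP R)"
      using b m by (auto simp: Pi_iff)
    then have fcl: "(\<Otimes>\<^bsub>UP R\<^esub> k \<in> {..<m'}. monic_linear R (b k)) \<in> carrier (UP R)"
      by (rule U.P.finprod_closed)
    have pe: "p = monic_linear R (b m') \<otimes>\<^bsub>UP R\<^esub> (\<Otimes>\<^bsub>UP R\<^esub> k \<in> {..<m'}. monic_linear R (b k))"
      unfolding b(2) m lessThan_Suc using cl bm by (intro U.P.finprod_insert) auto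
    interpret E: UP_pre_univ_prop R R id "UP R" by unfold_locales
    interpret ev: ring_hom_cring "UP R" R "eval R R id (b m')"
      by unfold_locales (rule E.eval_ring_hom[OF bm])
    have "eval R R id (b m') (monic_linear R (b m')) = \<zero>"
      unfolding monic_linear_def by (rule U.eval_monom_expr[OF bm])
    then have "eval R R id (b m') p = \<zero>"
      unfolding pe using bm fcl by simp
    moreover have "psum R (\<lambda>k. id (coeff (UP R) p k)) (b m') n = psum R a (b m') n"
      using p(3) by (intro psum_cong) simp
    ultimately show ?thesis
      using eval_monic[OF id.ring_hom_cring_axioms bm p(1)] p(2) bm by auto
  qed
qed

text \<open>The remainder theorem gives the quotient. Since degrees need not add up in the presence
  of zero divisors, its degree and leading coefficient are found by comparing coefficients.\<close>

lemma (in cring) monic_linear_factor: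
  assumes "\<one> \<noteq> \<zero>" and p: "monic R p" and s: "s \<in> carrier R" and root: "eval R R id s p = \<zero>"
  shows "\<exists>q. monic R q \<and> p = monic_linear R s \<otimes>\<^bsub>UP R\<^esub> q \<and> deg R p = Suc (deg R q)"
proof -
  interpret U: UP_cring R "UP R" by (rule UP_cring_UP) simp
  have pcl: "p \<in> carrier (UP R)" "coeff (UP R) p (deg R p) = \<one>"
    using p by (auto simp: monic_def)
  have "carrier R \<noteq> {\<zero>}"
    using assms(1) one_closed by blast
  from U.remainder_theorem[OF pcl(1) s this] obtain q where q: "q \<in> carrier (UP R)" "p = monic_linear R s \<otimes>\<^bsub>UP R\<^esub> q"
    unfolding root monic_linear_def using s by auto
  have X: "p = monom (UP R) \<one> 1 \<otimes>\<^bsub>UP R\<^esub> q \<ominus>\<^bsub>UP R\<^esub> monom (UP R) s 0 \<otimes>\<^bsub>UP R\<^esub> q"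
    unfolding q(2) monic_linear_def using q(1) s by (simp add: a_minus_def U.P.l_distr U.P.l_minus)
  \<comment> \<open>At \<open>k = deg R q\<close> the second term vanishes, so the leading
    coefficient of \<open>q\<close> is a coefficient of \<open>p\<close>; for larger
    \<open>k\<close> both terms vanish, which bounds the degree of \<open>p\<close>.\<close>
  have coeff_Suc: "coeff (UP R) p (Suc k) = coeff (UP R) q k \<ominus> s \<otimes> coeff (UP R) q (Suc k)" for k
    using U.coeff_monom_mult[of \<one> q 1 k] U.coeff_monom_mult[of s q 0 "Suc k"] q(1) s by (subst X) simp
  have "q \<noteq> \<zero>\<^bsub>UP R\<^esub>"
  proof
    assume "q = \<zero>\<^bsub>UP R\<^esub>"
    then have "p = \<zero>\<^bsub>UP R\<^esub>" using q s by simp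
    then show False using pcl assms(1) by simp
  qed
  then have lq: "coeff (UP R) q (deg R q) \<noteq> \<zero>"
    using U.lcoeff_nonzero q(1) by simp
  have top: "coeff (UP R) p (Suc (deg R q)) = coeff (UP R) q (deg R q)"
    unfolding coeff_Suc using U.deg_aboveD[of q "Suc (deg R q)"] q(1) s by (simp add: a_minus_def)
  have "deg R p = Suc (deg R q)"
  proof (rule antisym)
    show "deg R p \<le> Suc (deg R q)"
    proof (rule U.deg_aboveI[OF _ pcl(1)])
      fix m assume "Suc (deg R q) < m"
      then obtain k where "m = Suc k" "deg R q < k" by (cases m) auto
      then show "coeff (UP R) p m = \<zero>"
        using coeff_Suc U.deg_aboveD[of q] q(1) s by (simp add: a_minus_def)
    qed
    show "Suc (deg R q) \<le> deg R p"
      using lq top by (intro U.deg_belowI[OF _ pcl(1)]) simp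
  qed
  then show ?thesis
    using q top pcl by (intro exI[of _ q]) (simp add: monic_def)
qed

text \<open>Induction on the degree: a root is split off, and the monic quotient has degree one
  less.\<close>

lemma (in cring) rooted_imp_ai_closed:
  assumes "rooted R"
  shows "ai_closed R"
  unfolding ai_closed_def
proof (intro allI impI)
  fix p assume p: "monic R p"
  interpret U: UP_cring R "UP R" by (rule UP_cring_UP) simp
  interpret id: ring_hom_cring R R id by unfold_locales (simp add: ring_hom_def)
  show "\<exists>(n::nat) a. a \<in> {..<n} \<rightarrow> carrier R \<and> p = (\<Otimes>\<^bsub>UP R\<^esub> k \<in> {..<n}. monic_linear R (a k))"
  proof (cases "\<one> = \<zero>")
    case True
    then have triv: "carrier R = {\<zero>}" by (rule one_zeroD)
    have pcl: "p \<in> carrier (UP R)" using p by (simp add: monic_def)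
    \<comment> \<open>The zero ring has a single polynomial, which is the empty product.\<close>
    have "p = \<one>\<^bsub>UP R\<^esub>"
    proof (rule U.up_eqI)
      show "coeff (UP R) p n = coeff (UP R) \<one>\<^bsub>UP R\<^esub> n" for n
        using U.coeff_closed[OF pcl, of n] U.coeff_closed[OF U.UP_one_closed, of n] triv by auto
    qed (use pcl in auto)
    then show ?thesis by (intro exI[of _ 0]) simp
  next
    case False
    from p show ?thesis
    proof (induction "deg R p" arbitrary: p)
      case 0
      then have "p = monom (UP R) \<one> 0"
        using U.deg_zero_impl_monom[of p] by (simp add: monic_def)
      then show ?case by (intro exI[of _ 0]) simp
    next
      case (Suc d)
      let ?a = "coeff (UP R) p"
      have "\<forall>k<Suc d. ?a k \<in> carrier R"
        using Suc.prems by (simp add: monic_def)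
      then obtain s where s: "s \<in> carrier R" "s [^] Suc d \<oplus> psum R ?a s (Suc d) = \<zero>"
        using assms unfolding rooted_def by blast
      then have "eval R R id s p = \<zero>"
        using eval_monic[OF id.ring_hom_cring_axioms s(1) Suc.prems] by (simp flip: Suc.hyps(2))
      then obtain q where q: "monic R q" "p = monic_linear R s \<otimes>\<^bsub>UP R\<^esub> q" "deg R p = Suc (deg R q)"
        using monic_linear_factor[OF False Suc.prems s(1)] by blast
      obtain n :: nat and a where a: "a \<in> {..<n} \<rightarrow> carrier R"
          "q = (\<Otimes>\<^bsub>UP R\<^esub> k \<in> {..<n}. monic_linear R (a k))"
        using Suc.hyps(1)[of q] Suc.hyps(2) q by auto
      \<comment> \<open>The new root takes the index \<open>n\<close>, so the factors of
        \<open>q\<close> keep theirs.\<close>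
      let ?b = "a(n := s)"
      have "(\<Otimes>\<^bsub>UP R\<^esub> k \<in> {..<Suc n}. monic_linear R (?b k))
          = monic_linear R (?b n) \<otimes>\<^bsub>UP R\<^esub> (\<Otimes>\<^bsub>UP R\<^esub> k \<in> {..<n}. monic_linear R (?b k))"
        unfolding lessThan_Suc using a(1) s(1) by (intro U.P.finprod_insert) (auto simp: Pi_iff)
      also have "(\<Otimes>\<^bsub>UP R\<^esub> k \<in> {..<n}. monic_linear R (?b k)) = q"
        unfolding a(2) using a(1) by (intro U.P.finprod_cong') (auto simp: Pi_iff)
      finally have "p = (\<Otimes>\<^bsub>UP R\<^esub> k \<in> {..<Suc n}. monic_linear R (?b k))"
        using q(2) by simp
      moreover have "?b \<in> {..<Suc n} \<rightarrow> carrier R"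
        using a(1) s(1) by (auto simp: less_Suc_eq)
      ultimately show ?case by blast
    qed
  qed
qed

lemma (in cring) ai_closed_iff_rooted: "ai_closed R \<longleftrightarrow> rooted R"
  using ai_closed_imp_rooted rooted_imp_ai_closed by blast

section \<open>Change of ring and scaling of polynomial values\<close>

lemma pow_subring [simp]: "x [^]\<^bsub>R\<lparr>carrier := A\<rparr>\<^esub> (n::nat) = x [^]\<^bsub>R\<^esub> n"
  by (simp add: nat_pow_def)

lemma psum_subring [simp]: "psum (R\<lparr>carrier := A\<rparr>) a s n = psum R a s n"
  by (induction n) simp_all

lemma (in ring_hom_cring) hom_psum:
  assumes "s \<in> carrier R" "\<And>k. k < n \<Longrightarrow> a k \<in> carrier R"
  shows "h (psum R a s n) = psum S (\<lambda>k. h (a k)) (h s) n"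
  using assms(2) by (induction n) (auto simp: assms(1))

lemma (in ring_hom_cring) hom_below:
  assumes "s \<in> carrier R" "K \<subseteq> carrier R" "x \<in> below R K s n"
  shows "x \<in> carrier R \<and> h x \<in> below S (h ` K) (h s) n"
  using assms(3)
proof (induction n arbitrary: x)
  case (Suc n)
  then obtain y k where *: "x = y \<oplus> k \<otimes> s [^] n" "y \<in> below R K s n" "k \<in> K"
    by (auto elim!: below_SucE)
  have "h x = h y \<oplus>\<^bsub>S\<^esub> h k \<otimes>\<^bsub>S\<^esub> h s [^]\<^bsub>S\<^esub> n"
    using * Suc.IH[OF *(2)] assms by auto
  then show ?case
    using * Suc.IH[OF *(2)] assms by (auto intro!: below_SucI)
qed simp

lemma (in ring_hom_cring) hom_integral_elt:
  assumes "K \<subseteq> carrier R" "integral_elt R K s"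
  shows "integral_elt S (h ` K) (h s)"
proof -
  obtain n where n: "s [^] n \<in> below R K s n" and s: "s \<in> carrier R"
    using assms(2) by (auto simp: integral_elt_def)
  have "h (s [^] n) \<in> below S (h ` K) (h s) n"
    using hom_below[OF s assms(1) n] by blast
  then show ?thesis
    using s by (auto simp: integral_elt_def)
qed

text \<open>The substitution that clears denominators: for \<open>k < n\<close> one has
  \<open>v^n u^(n-1-k) s^k = v (s v)^k\<close>, as \<open>v\<close> is inverse to \<open>u\<close>.
  The exponent \<open>n\<close> stays fixed while the length \<open>m\<close> of the sum grows in
  the induction.\<close>

lemma (in cring) psum_scale:
  assumes uv: "u \<otimes> v = \<one>" and cl: "u \<in> carrier R" "v \<in> carrier R" "s \<in> carrier R"
    and b: "\<And>k. k < n \<Longrightarrow> b k \<in> carrier R" and "m \<le> n"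
  shows "v [^] n \<otimes> psum R (\<lambda>k. u [^] (n - Suc k) \<otimes> b k) s m = psum R (\<lambda>k. b k \<otimes> v) (s \<otimes> v) m"
  using \<open>m \<le> n\<close>
proof (induction m)
  case 0
  then show ?case using cl by simp
next
  case (Suc m)
  let ?d = "n - Suc m"
  have bm: "b m \<in> carrier R" using b Suc.prems by simp
  have pcl: "psum R (\<lambda>k. u [^] (n - Suc k) \<otimes> b k) s m \<in> carrier R"
    using b cl Suc.prems by (intro psum_closed) auto
  have "n = Suc m + ?d" using Suc.prems by simp
  then have "v [^] n = v [^] m \<otimes> v \<otimes> v [^] ?d"
    using cl nat_pow_mult[of v "Suc m" ?d] by simp
  then have "v [^] n \<otimes> (u [^] ?d \<otimes> b m \<otimes> s [^] m)
      = (u [^] ?d \<otimes> v [^] ?d) \<otimes> (b m \<otimes> v \<otimes> (s [^] m \<otimes> v [^] m))"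
    using cl bm by (simp add: m_ac)
  also have "\<dots> = b m \<otimes> v \<otimes> (s \<otimes> v) [^] m"
    using cl bm uv by (simp flip: nat_pow_distrib)
  finally show ?case
    using Suc cl bm pcl by (simp add: r_distr)
qed

section \<open>Rings of fractions\<close>

text \<open>Tightness is stated as an intersection different from the zero set; for a set containing
  zero this yields a nonzero element.\<close>

lemma not_zero_singletonD:
  assumes "A \<noteq> {z}" "z \<in> A"
  obtains x where "x \<in> A" "x \<noteq> z"
  using assms by blast

context loc_data
begin

lemma fraction_hom: "ring_hom_cring R (loc R F) (\<lambda>a. fraction R F a \<one>)"
proof (rule ring_hom_cringI)
  show "cring R" by (rule is_cring)
  show "cring (loc R F)" by (rule cring_loc)
  show "(\<lambda>a. fraction R F a \<one>) \<in> ring_hom R (loc R F)"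
    by (rule ring_hom_memI) (simp_all add: mult_loc add_loc one_loc)
qed

lemma fraction_split:
  assumes "a \<in> carrier R" "f \<in> F"
  shows "fraction R F a f = fraction R F a \<one> \<otimes>\<^bsub>loc R F\<^esub> fraction R F \<one> f"
  using assms by (simp add: mult_loc)

lemma fraction_cancel:
  assumes "a \<in> carrier R" "f \<in> F"
  shows "fraction R F a f \<otimes>\<^bsub>loc R F\<^esub> fraction R F f \<one> = fraction R F a \<one>"
  using assms by (simp add: mult_loc) (rule fraction_eqI; simp)

lemma fraction_scale:
  assumes "a \<in> carrier R" "f \<in> F" "g \<in> F"
  shows "fraction R F (a \<otimes> g) (f \<otimes> g) = fraction R F a f"
  using assms by (intro fraction_eqI) (simp_all add: m_ac)

lemma fraction_inj:
  assumes "F \<subseteq> reg R" "a \<in> carrier R" "b \<in> carrier R" "fraction R F a \<one> = fraction R F b \<one>"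
  shows "a = b"
proof -
  obtain t where t: "t \<in> F" "t \<otimes> a = t \<otimes> b"
    using assms fraction_eq_iff[of a \<one> b \<one>] by auto
  then have "t \<otimes> (a \<ominus> b) = \<zero>"
    using assms(2,3) by (simp add: a_minus_def r_distr r_minus r_neg)
  moreover have "t \<in> reg R" using assms(1) t(1) by blast
  ultimately have "a \<ominus> b = \<zero>"
    using assms(2,3) unfolding reg_def by blast
  then show ?thesis using assms(2,3) by simp
qed

lemma common_denominator:
  assumes "\<And>k. k < (n::nat) \<Longrightarrow> a k \<in> carrier (loc R F)"
  shows "\<exists>f \<in> F. \<exists>b. \<forall>k<n. b k \<in> carrier R \<and> a k = fraction R F (b k) f"
  using assms
proof (induction n)
  case 0
  then show ?case using F.one_closed by blast
next
  case (Suc n)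
  have "\<exists>f \<in> F. \<exists>b. \<forall>k<n. b k \<in> carrier R \<and> a k = fraction R F (b k) f"
    using Suc.prems by (intro Suc.IH) simp
  then obtain f b where f: "f \<in> F" "\<forall>k<n. b k \<in> carrier R \<and> a k = fraction R F (b k) f"
    by blast
  obtain c g where c: "a n = fraction R F c g" "c \<in> carrier R" "g \<in> F"
    using Suc.prems[of n] by (auto elim: loc_cases)
  \<comment> \<open>Over the denominator \<open>f g\<close>, the old numerators gain the factor
    \<open>g\<close> and the new one the factor \<open>f\<close>.\<close>
  let ?b = "\<lambda>k. if k < n then b k \<otimes> g else c \<otimes> f"
  have "?b k \<in> carrier R \<and> a k = fraction R F (?b k) (f \<otimes> g)" if "k < Suc n" for k
  proof (cases "k < n")
    case True
    then show ?thesis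
      using f c(3) fraction_scale[of "b k" f g] by simp
  next
    case False
    then have "k = n" using that by simp
    then show ?thesis
      using f(1) c fraction_scale[of c g f] by (simp add: m_comm[of g f])
  qed
  then show ?case
    using f c by (intro bexI[of _ "f \<otimes> g"] exI[of _ ?b]) auto
qed

text \<open>If the coefficients are \<open>b k / f\<close> with a common denominator, a root
  \<open>s\<close> in \<open>R\<close> of the polynomial with lower coefficients
  \<open>f^(n-1-k) b k\<close> yields the root \<open>s / f\<close>.\<close>

lemma rooted_loc:
  assumes "rooted R"
  shows "rooted (loc R F)"
  unfolding rooted_def
proof (intro allI impI)
  fix n :: nat and a assume n: "n > 0" and a: "\<forall>k<n. a k \<in> carrier (loc R F)"
  interpret E: ring_hom_cring R "loc R F" "\<lambda>a. fraction R F a \<one>" by (rule fraction_hom)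
  obtain f b where f: "f \<in> F" and fb: "\<forall>k<n. b k \<in> carrier R \<and> a k = fraction R F (b k) f"
    using common_denominator[of n a] a by blast
  then have b: "b k \<in> carrier R" "a k = fraction R F (b k) f" if "k < n" for k
    using that by auto
  define c where "c = (\<lambda>k. f [^] (n - Suc k) \<otimes> b k)"
  have c: "c k \<in> carrier R" if "k < n" for k
    using that b f by (simp add: c_def)
  then obtain s where s: "s \<in> carrier R" "s [^] n \<oplus> psum R c s n = \<zero>"
    using assms n unfolding rooted_def by blast
  let ?u = "fraction R F f \<one>" and ?v = "fraction R F \<one> f" and ?s = "fraction R F s \<one>"
  let ?x = "?s \<otimes>\<^bsub>loc R F\<^esub> ?v"
  have cl: "?u \<in> carrier (loc R F)" "?v \<in> carrier (loc R F)" "?s \<in> carrier (loc R F)"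
    using f s by auto
  have uv: "?u \<otimes>\<^bsub>loc R F\<^esub> ?v = \<one>\<^bsub>loc R F\<^esub>"
    using fraction_cancel[of \<one> f] f E.S.m_comm[OF cl(1,2)] by simp
  have "psum (loc R F) (\<lambda>k. fraction R F (c k) \<one>) ?s n
      = psum (loc R F) (\<lambda>k. ?u [^]\<^bsub>loc R F\<^esub> (n - Suc k) \<otimes>\<^bsub>loc R F\<^esub> fraction R F (b k) \<one>) ?s n"
    using b f by (intro psum_cong) (simp add: c_def)
  then have "?v [^]\<^bsub>loc R F\<^esub> n \<otimes>\<^bsub>loc R F\<^esub> psum (loc R F) (\<lambda>k. fraction R F (c k) \<one>) ?s n
      = psum (loc R F) (\<lambda>k. fraction R F (b k) \<one> \<otimes>\<^bsub>loc R F\<^esub> ?v) ?x n"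
    using E.S.psum_scale[OF uv cl, of n "\<lambda>k. fraction R F (b k) \<one>" n] b by simp
  also have "\<dots> = psum (loc R F) a ?x n"
    using b f by (intro psum_cong) (simp flip: fraction_split)
  finally have *: "?v [^]\<^bsub>loc R F\<^esub> n \<otimes>\<^bsub>loc R F\<^esub> psum (loc R F) (\<lambda>k. fraction R F (c k) \<one>) ?s n
      = psum (loc R F) a ?x n" .
  have pcl: "psum (loc R F) (\<lambda>k. fraction R F (c k) \<one>) ?s n \<in> carrier (loc R F)"
    using c cl by (intro E.S.psum_closed) auto
  have "?s [^]\<^bsub>loc R F\<^esub> n \<oplus>\<^bsub>loc R F\<^esub> psum (loc R F) (\<lambda>k. fraction R F (c k) \<one>) ?s n
      = fraction R F (s [^] n \<oplus> psum R c s n) \<one>"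
    using E.hom_psum[OF s(1), of n c] c s(1) by simp
  also have "\<dots> = \<zero>\<^bsub>loc R F\<^esub>"
    unfolding s(2) by (rule E.hom_zero)
  finally have "?v [^]\<^bsub>loc R F\<^esub> n \<otimes>\<^bsub>loc R F\<^esub> (?s [^]\<^bsub>loc R F\<^esub> n \<oplus>\<^bsub>loc R F\<^esub>
      psum (loc R F) (\<lambda>k. fraction R F (c k) \<one>) ?s n) = \<zero>\<^bsub>loc R F\<^esub>"
    using cl by simp
  then have "?x [^]\<^bsub>loc R F\<^esub> n \<oplus>\<^bsub>loc R F\<^esub> psum (loc R F) a ?x n = \<zero>\<^bsub>loc R F\<^esub>"
    using cl pcl * by (simp add: E.S.r_distr E.S.nat_pow_distrib E.S.m_comm)
  then show "\<exists>x \<in> carrier (loc R F). x [^]\<^bsub>loc R F\<^esub> n \<oplus>\<^bsub>loc R F\<^esub> psum (loc R F) a x n = \<zero>\<^bsub>loc R F\<^esub>"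
    using cl by blast
qed

text \<open>The universal property of \<open>loc R F\<close>. The value at \<open>a/f\<close> is
  described by a product with \<open>h f\<close>, so that later uses need no inverses.\<close>

lemma loc_lift:
  assumes "ring_hom_cring R T h" and units: "h ` F \<subseteq> Units T"
  shows "\<exists>H \<in> ring_hom (loc R F) T. \<forall>a \<in> carrier R. \<forall>f \<in> F. H (fraction R F a f) \<otimes>\<^bsub>T\<^esub> h f = h a"
proof -
  interpret h: ring_hom_cring R T h by fact
  \<comment> \<open>\<open>H\<close> is computed on a chosen representative of the class;
    independence of the choice is the content of the fact \<open>H\<close>.\<close>
  define rep where "rep x = (SOME p. x = fraction R F (fst p) (snd p) \<and> fst p \<in> carrier R \<and> snd p \<in> F)" for x
  define H where "H = (\<lambda>x. h (fst (rep x)) \<otimes>\<^bsub>T\<^esub> inv\<^bsub>T\<^esub> h (snd (rep x)))"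
  have unit: "h f \<in> Units T" "h f \<in> carrier T" "inv\<^bsub>T\<^esub> h f \<in> carrier T" if "f \<in> F" for f
    using that units by auto
  have H: "H (fraction R F a f) \<in> carrier T \<and> H (fraction R F a f) \<otimes>\<^bsub>T\<^esub> h f = h a"
    if af: "a \<in> carrier R" "f \<in> F" for a f
  proof -
    let ?x = "fraction R F a f"
    obtain b g where bg: "rep ?x = (b, g)" by fastforce
    have "\<exists>p. ?x = fraction R F (fst p) (snd p) \<and> fst p \<in> carrier R \<and> snd p \<in> F"
      using af by (intro exI[of _ "(a, f)"]) simp
    from someI_ex[OF this, folded rep_def] bg
    have b: "?x = fraction R F b g" "b \<in> carrier R" "g \<in> F"
      by simp_all
    then obtain t where t: "t \<in> F" "t \<otimes> (a \<otimes> g) = t \<otimes> (b \<otimes> f)"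
      using fraction_eq_iff[of a f b g] af by auto
    have "h t \<otimes>\<^bsub>T\<^esub> (h a \<otimes>\<^bsub>T\<^esub> h g) = h t \<otimes>\<^bsub>T\<^esub> (h b \<otimes>\<^bsub>T\<^esub> h f)"
      using arg_cong[OF t(2), of h] t(1) af b by simp
    then have eq: "h a \<otimes>\<^bsub>T\<^esub> h g = h b \<otimes>\<^bsub>T\<^esub> h f"
      using unit[OF t(1)] af b by simp
    have "h b \<otimes>\<^bsub>T\<^esub> inv\<^bsub>T\<^esub> h g \<otimes>\<^bsub>T\<^esub> h f = (h b \<otimes>\<^bsub>T\<^esub> h f) \<otimes>\<^bsub>T\<^esub> inv\<^bsub>T\<^esub> h g"
      using unit b af by (simp add: h.S.m_ac)
    also have "\<dots> = h a"
      unfolding eq[symmetric] using unit[OF b(3)] af(1) by (simp add: h.S.m_assoc)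
    finally show ?thesis
      using unit[OF b(3)] b(2) by (simp add: H_def bg)
  qed
  \<comment> \<open>As \<open>h f\<close> is a unit, the equation \<open>y (h f) = h a\<close>
    determines the value at \<open>a/f\<close>. Each homomorphism law is then one check of this
    equation.\<close>
  have uniq: "H (fraction R F a f) = y" if "a \<in> carrier R" "f \<in> F" "y \<in> carrier T" "y \<otimes>\<^bsub>T\<^esub> h f = h a" for a f y
  proof -
    have "h f \<otimes>\<^bsub>T\<^esub> H (fraction R F a f) = h f \<otimes>\<^bsub>T\<^esub> y"
      using H[OF that(1,2)] that unit(2)[OF that(2)]
      by (simp add: h.S.m_comm[of "h f" "H (fraction R F a f)"] h.S.m_comm[of "h f" y])
    then show ?thesis
      using h.S.Units_l_cancel[of "h f" "H (fraction R F a f)" y] unit(1)[OF that(2)] H[OF that(1,2)] that(3)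
      by simp
  qed
  have mult_4: "(p \<otimes>\<^bsub>T\<^esub> q) \<otimes>\<^bsub>T\<^esub> (u \<otimes>\<^bsub>T\<^esub> v) = (p \<otimes>\<^bsub>T\<^esub> u) \<otimes>\<^bsub>T\<^esub> (q \<otimes>\<^bsub>T\<^esub> v)"
    and add_4: "(p \<oplus>\<^bsub>T\<^esub> q) \<otimes>\<^bsub>T\<^esub> (u \<otimes>\<^bsub>T\<^esub> v) = (p \<otimes>\<^bsub>T\<^esub> u) \<otimes>\<^bsub>T\<^esub> v \<oplus>\<^bsub>T\<^esub> (q \<otimes>\<^bsub>T\<^esub> v) \<otimes>\<^bsub>T\<^esub> u"
    if "p \<in> carrier T" "q \<in> carrier T" "u \<in> carrier T" "v \<in> carrier T" for p q u v
    using that by (simp_all add: h.S.m_ac h.S.l_distr h.S.r_distr)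
  have "H \<in> ring_hom (loc R F) T"
  proof (rule ring_hom_memI)
    fix x y assume "x \<in> carrier (loc R F)" "y \<in> carrier (loc R F)"
    then obtain a f b g where x: "x = fraction R F a f" "a \<in> carrier R" "f \<in> F"
        and y: "y = fraction R F b g" "b \<in> carrier R" "g \<in> F"
      by (auto elim!: loc_cases)
    note Hx = H[OF x(2,3), folded x(1)] and Hy = H[OF y(2,3), folded y(1)]
    note fg = unit(2)[OF x(3)] unit(2)[OF y(3)]
    have "(H x \<otimes>\<^bsub>T\<^esub> H y) \<otimes>\<^bsub>T\<^esub> (h f \<otimes>\<^bsub>T\<^esub> h g) = (H x \<otimes>\<^bsub>T\<^esub> h f) \<otimes>\<^bsub>T\<^esub> (H y \<otimes>\<^bsub>T\<^esub> h g)"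
      by (rule mult_4) (use Hx Hy fg in auto)
    then show "H (x \<otimes>\<^bsub>loc R F\<^esub> y) = H x \<otimes>\<^bsub>T\<^esub> H y"
      using Hx Hy x y uniq[of "a \<otimes> b" "f \<otimes> g" "H x \<otimes>\<^bsub>T\<^esub> H y"]
      by (simp add: mult_loc)
    have "(H x \<oplus>\<^bsub>T\<^esub> H y) \<otimes>\<^bsub>T\<^esub> (h f \<otimes>\<^bsub>T\<^esub> h g)
        = (H x \<otimes>\<^bsub>T\<^esub> h f) \<otimes>\<^bsub>T\<^esub> h g \<oplus>\<^bsub>T\<^esub> (H y \<otimes>\<^bsub>T\<^esub> h g) \<otimes>\<^bsub>T\<^esub> h f"
      by (rule add_4) (use Hx Hy fg in auto)
    then show "H (x \<oplus>\<^bsub>loc R F\<^esub> y) = H x \<oplus>\<^bsub>T\<^esub> H y"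
      using Hx Hy x y uniq[of "a \<otimes> g \<oplus> b \<otimes> f" "f \<otimes> g" "H x \<oplus>\<^bsub>T\<^esub> H y"]
      by (simp add: add_loc)
  next
    fix x assume "x \<in> carrier (loc R F)"
    then show "H x \<in> carrier T" using H by (auto elim!: loc_cases)
  next
    show "H \<one>\<^bsub>loc R F\<^esub> = \<one>\<^bsub>T\<^esub>"
      using uniq[of \<one> \<one> "\<one>\<^bsub>T\<^esub>"] by (simp add: one_loc)
  qed
  then show ?thesis using H by (intro bexI[of _ H]) simp
qed

end

section \<open>Localisation of an absolute integral closure\<close>

lemma loc_data_image:
  assumes "loc_data R F" "ring_hom_cring R S i"
  shows "loc_data S (i ` F)"
proof -
  interpret R: loc_data R F by fact
  interpret ring_hom_cring R S i by fact
  interpret F': submonoid "i ` F" S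
    by standard (auto simp flip: hom_mult intro: rev_image_eqI[where x = "\<one>\<^bsub>R\<^esub>"])
  show ?thesis ..
qed

lemma loc_map_hom:
  assumes "loc_data R F" "ring_hom_cring R S i"
  shows "ring_hom_cring (loc R F) (loc S (i ` F)) (loc_map S F i)"
proof -
  interpret R: loc_data R F by fact
  interpret ring_hom_cring R S i by fact
  interpret S: loc_data S "i ` F" by (rule loc_data_image[OF assms])
  note frac = loc_map_fraction[OF assms]
  show ?thesis
  proof (rule ring_hom_cringI[OF R.cring_loc S.cring_loc], rule ring_hom_memI)
    fix x y assume "x \<in> carrier (loc R F)" "y \<in> carrier (loc R F)"
    then obtain a f b g where x: "x = fraction R F a f" "a \<in> carrier R" "f \<in> F"
        and y: "y = fraction R F b g" "b \<in> carrier R" "g \<in> F"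
      by (auto elim!: R.loc_cases)
    show "loc_map S F i (x \<otimes>\<^bsub>loc R F\<^esub> y)
        = loc_map S F i x \<otimes>\<^bsub>loc S (i ` F)\<^esub> loc_map S F i y"
      using x y by (simp add: R.mult_loc S.mult_loc frac)
    show "loc_map S F i (x \<oplus>\<^bsub>loc R F\<^esub> y)
        = loc_map S F i x \<oplus>\<^bsub>loc S (i ` F)\<^esub> loc_map S F i y"
      using x y by (simp add: R.add_loc S.add_loc frac)
  next
    fix x assume "x \<in> carrier (loc R F)"
    then show "loc_map S F i x \<in> carrier (loc S (i ` F))"
      by (auto elim!: R.loc_cases simp: frac)
  next
    show "loc_map S F i \<one>\<^bsub>loc R F\<^esub> = \<one>\<^bsub>loc S (i ` F)\<^esub>"
      by (simp add: R.one_loc S.one_loc frac)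
  qed
qed

lemma tight_extension_reg:
  assumes "ring_extension R S i" "tight R S i" "F \<subseteq> reg R"
  shows "i ` F \<subseteq> reg S"
proof
  fix y assume "y \<in> i ` F"
  then obtain f where f: "y = i f" "f \<in> reg R"
    using assms(3) by blast
  interpret ring_hom_cring R S i
    using assms(1) by (simp add: ring_extension_def)
  have fcl: "f \<in> carrier R" using f by (simp add: reg_def)
  define J where "J = {x \<in> carrier S. i f \<otimes>\<^bsub>S\<^esub> x = \<zero>\<^bsub>S\<^esub>}"
  have "ideal J S"
  proof (rule idealI[OF S.ring_axioms])
    show "subgroup J (add_monoid S)"
      using fcl by (intro S.add.subgroupI) (auto simp: J_def S.r_distr S.r_minus simp flip: a_inv_def intro: exI[of _ "\<zero>\<^bsub>S\<^esub>"])
    show "x \<otimes>\<^bsub>S\<^esub> a \<in> J" if "a \<in> J" "x \<in> carrier S" for a x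
      using that fcl by (auto simp: J_def S.m_lcomm)
    show "a \<otimes>\<^bsub>S\<^esub> x \<in> J" if "a \<in> J" "x \<in> carrier S" for a x
      using that fcl by (auto simp: J_def simp flip: S.m_assoc)
  qed
  \<comment> \<open>If \<open>i f\<close> annihilates \<open>i r\<close>, injectivity of
    \<open>i\<close> gives \<open>f r = 0\<close> in \<open>R\<close>, and \<open>f\<close> is
    regular there.\<close>
  moreover have "J \<inter> i ` carrier R = {\<zero>\<^bsub>S\<^esub>}"
  proof -
    have "i r = \<zero>\<^bsub>S\<^esub>" if "r \<in> carrier R" "i r \<in> J" for r
    proof -
      have "i (f \<otimes>\<^bsub>R\<^esub> r) = i \<zero>\<^bsub>R\<^esub>"
        using that fcl by (simp add: J_def)
      then have "f \<otimes>\<^bsub>R\<^esub> r = \<zero>\<^bsub>R\<^esub>"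
        using assms(1) that fcl inj_onD[of i "carrier R" "f \<otimes>\<^bsub>R\<^esub> r" "\<zero>\<^bsub>R\<^esub>"]
        by (simp only: ring_extension_def) simp
      then show ?thesis using f that by (auto simp: reg_def)
    qed
    moreover have "\<zero>\<^bsub>S\<^esub> \<in> J \<inter> i ` carrier R"
      using fcl by (auto simp: J_def intro!: image_eqI[of _ _ "\<zero>\<^bsub>R\<^esub>"])
    ultimately show ?thesis by auto
  qed
  ultimately have "J = {\<zero>\<^bsub>S\<^esub>}"
    using assms(2) unfolding tight_def by blast
  then show "y \<in> reg S"
    using f fcl by (auto simp: reg_def J_def)
qed

text \<open>The working form of the definition: no \<open>UP\<close>, and powers,
  \<open>psum\<close> and \<open>below\<close> do not see the carrier, so the conditions are easy to
  move to a subring.\<close>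

lemma is_aic_iff:
  "is_aic R S i \<longleftrightarrow> ring_hom_cring R S i \<and> inj_on i (carrier R) \<and> rooted S \<and>
     (\<forall>s \<in> carrier S. integral_elt S (i ` carrier R) s) \<and> tight R S i"
  unfolding is_aic_def ring_extension_def
  using ring_hom_cring.integral_over_iff[of R S i] cring.ai_closed_iff_rooted[of S]
  by (auto simp: ring_hom_cring_def)

lemma is_aic_loc:
  assumes "loc_data R F" "F \<subseteq> reg R" "is_aic R S i"
  shows "is_aic (loc R F) (loc S (i ` F)) (loc_map S F i)"
proof -
  interpret R: loc_data R F by fact
  from assms(3) have i: "ring_hom_cring R S i" "inj_on i (carrier R)" and S: "rooted S"
    and int: "\<And>s. s \<in> carrier S \<Longrightarrow> integral_elt S (i ` carrier R) s" and tight: "tight R S i"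
    by (auto simp: is_aic_iff)
  interpret i: ring_hom_cring R S i by fact
  interpret S: loc_data S "i ` F" by (rule loc_data_image[OF assms(1) i(1)])
  interpret m: ring_hom_cring "loc R F" "loc S (i ` F)" "loc_map S F i"
    by (rule loc_map_hom[OF assms(1) i(1)])
  interpret E: ring_hom_cring S "loc S (i ` F)" "\<lambda>a. fraction S (i ` F) a \<one>\<^bsub>S\<^esub>" by (rule S.fraction_hom)
  note frac = loc_map_fraction[OF assms(1) i(1)]
  have regS: "i ` F \<subseteq> reg S"
    using tight_extension_reg[OF _ tight assms(2)] i by (simp add: ring_extension_def)
  let ?L = "loc S (i ` F)"
  let ?K = "loc_map S F i ` carrier (loc R F)"
  have K: "subring ?K ?L" by (rule m.carrier_image_subring)
  \<comment> \<open>Equality of the images is an identity in \<open>S\<close> between elements of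
    the image of \<open>R\<close>, the factor \<open>i t\<close> included, so injectivity of
    \<open>i\<close> carries it back.\<close>
  have inj: "inj_on (loc_map S F i) (carrier (loc R F))"
  proof (rule inj_onI)
    fix x y assume "x \<in> carrier (loc R F)" "y \<in> carrier (loc R F)"
      and eq: "loc_map S F i x = loc_map S F i y"
    then obtain a f b g where x: "x = fraction R F a f" "a \<in> carrier R" "f \<in> F"
        and y: "y = fraction R F b g" "b \<in> carrier R" "g \<in> F"
      by (auto elim!: R.loc_cases)
    have "fraction S (i ` F) (i a) (i f) = fraction S (i ` F) (i b) (i g)"
      using eq x y frac by simp
    then obtain t where t: "t \<in> F" "i t \<otimes>\<^bsub>S\<^esub> (i a \<otimes>\<^bsub>S\<^esub> i g) = i t \<otimes>\<^bsub>S\<^esub> (i b \<otimes>\<^bsub>S\<^esub> i f)"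
      using S.fraction_eq_iff[of "i a" "i f" "i b" "i g"] x y by auto
    then have "i (t \<otimes>\<^bsub>R\<^esub> (a \<otimes>\<^bsub>R\<^esub> g)) = i (t \<otimes>\<^bsub>R\<^esub> (b \<otimes>\<^bsub>R\<^esub> f))"
      using x y by simp
    then have "t \<otimes>\<^bsub>R\<^esub> (a \<otimes>\<^bsub>R\<^esub> g) = t \<otimes>\<^bsub>R\<^esub> (b \<otimes>\<^bsub>R\<^esub> f)"
      using x y t(1) by (intro inj_onD[OF i(2)]) simp_all
    then show "x = y"
      unfolding x(1) y(1) using x y t(1) R.fraction_eq_iff[of a f b g] by blast
  qed
  \<comment> \<open>In \<open>s/f = (s/1) (1/f)\<close> the first factor is the image of an integral
    element and the second lies in the base ring; integral elements form a subring.\<close>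
  have integral: "integral_elt ?L ?K x" if x: "x \<in> carrier ?L" for x
  proof -
    obtain s f where s: "x = fraction S (i ` F) s (i f)" "s \<in> carrier S" "f \<in> F"
      using x by (auto elim!: S.loc_cases)
    have "(\<lambda>a. fraction S (i ` F) a \<one>\<^bsub>S\<^esub>) ` i ` carrier R \<subseteq> ?K"
    proof clarify
      fix r assume r: "r \<in> carrier R"
      have "fraction S (i ` F) (i r) \<one>\<^bsub>S\<^esub> = loc_map S F i (fraction R F r \<one>\<^bsub>R\<^esub>)"
        using r frac[of r "\<one>\<^bsub>R\<^esub>"] by simp
      then show "fraction S (i ` F) (i r) \<one>\<^bsub>S\<^esub> \<in> ?K"
        using R.fraction_closed[OF r R.F.one_closed] by (rule image_eqI)
    qed
    moreover have "integral_elt ?L ((\<lambda>a. fraction S (i ` F) a \<one>\<^bsub>S\<^esub>) ` i ` carrier R) (fraction S (i ` F) s \<one>\<^bsub>S\<^esub>)"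
      by (rule E.hom_integral_elt[OF _ int[OF s(2)]]) auto
    ultimately have 1: "integral_elt ?L ?K (fraction S (i ` F) s \<one>\<^bsub>S\<^esub>)"
      by (rule integral_elt_mono[rotated])
    have "fraction S (i ` F) \<one>\<^bsub>S\<^esub> (i f) = loc_map S F i (fraction R F \<one>\<^bsub>R\<^esub> f)"
      using s frac[of "\<one>\<^bsub>R\<^esub>" f] by simp
    then have 2: "integral_elt ?L ?K (fraction S (i ` F) \<one>\<^bsub>S\<^esub> (i f))"
      using s by (intro m.S.integral_elt_base[OF K] image_eqI) auto
    have "x = fraction S (i ` F) s \<one>\<^bsub>S\<^esub> \<otimes>\<^bsub>?L\<^esub> fraction S (i ` F) \<one>\<^bsub>S\<^esub> (i f)"
      unfolding s(1) using s by (intro S.fraction_split) auto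
    then show ?thesis
      using subringE(6)[OF m.S.integral_closure_subring[OF K]] 1 2 by (simp add: integral_elt_def)
  qed
  have "tight (loc R F) ?L (loc_map S F i)"
    unfolding tight_def
  proof (intro allI impI)
    fix J assume J: "ideal J ?L" "J \<noteq> {\<zero>\<^bsub>?L\<^esub>}"
    interpret J: ideal J ?L by (rule J(1))
    have Jz: "\<zero>\<^bsub>?L\<^esub> \<in> J" by (rule J.zero_closed)
    obtain x where x: "x \<in> J" "x \<noteq> \<zero>\<^bsub>?L\<^esub>"
      by (rule not_zero_singletonD[OF J(2) Jz])
    obtain s f where s: "x = fraction S (i ` F) s f" "s \<in> carrier S" "f \<in> i ` F"
      using J.Icarr[OF x(1)] by (auto elim!: S.loc_cases)
    \<comment> \<open>The contraction of \<open>J\<close> to \<open>S\<close>. It is nonzero because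
      it contains the numerator of \<open>x\<close>.\<close>
    let ?J = "{s \<in> carrier S. fraction S (i ` F) s \<one>\<^bsub>S\<^esub> \<in> J}"
    have "fraction S (i ` F) s \<one>\<^bsub>S\<^esub> = x \<otimes>\<^bsub>?L\<^esub> fraction S (i ` F) f \<one>\<^bsub>S\<^esub>"
      unfolding s(1) using S.fraction_cancel[OF s(2,3)] by simp
    moreover have "\<dots> \<in> J"
      using J.I_r_closed[OF x(1)] S.fraction_closed[of f "\<one>\<^bsub>S\<^esub>"] s(3) by auto
    ultimately have sJ: "s \<in> ?J"
      using s(2) by simp
    have "s \<noteq> \<zero>\<^bsub>S\<^esub>"
    proof
      assume "s = \<zero>\<^bsub>S\<^esub>"
      then have "x = \<zero>\<^bsub>?L\<^esub>"
        unfolding s(1) S.zero_loc using s by (intro S.fraction_eqI) auto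
      then show False using x(2) by simp
    qed
    then have "?J \<noteq> {\<zero>\<^bsub>S\<^esub>}"
      using sJ by blast
    moreover have idealJ: "ideal ?J S"
      using E.ring.ideal_vimage[OF J(1)] by simp
    ultimately have ne: "?J \<inter> i ` carrier R \<noteq> {\<zero>\<^bsub>S\<^esub>}"
      using tight unfolding tight_def by blast
    have "\<zero>\<^bsub>S\<^esub> \<in> ?J \<inter> i ` carrier R"
      using Jz E.hom_zero by (auto intro!: image_eqI[of _ _ "\<zero>\<^bsub>R\<^esub>"])
    then obtain y where y: "y \<in> ?J \<inter> i ` carrier R" "y \<noteq> \<zero>\<^bsub>S\<^esub>"
      by (rule not_zero_singletonD[OF ne])
    then obtain r where r: "r \<in> carrier R" "y = i r" by blast
    let ?y = "fraction S (i ` F) y \<one>\<^bsub>S\<^esub>"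
    have "?y = loc_map S F i (fraction R F r \<one>\<^bsub>R\<^esub>)"
      using r frac[of r "\<one>\<^bsub>R\<^esub>"] by simp
    then have "?y \<in> J \<inter> ?K"
      using y r by auto
    moreover have "?y \<noteq> \<zero>\<^bsub>?L\<^esub>"
    proof
      assume "?y = \<zero>\<^bsub>?L\<^esub>"
      then have "?y = fraction S (i ` F) \<zero>\<^bsub>S\<^esub> \<one>\<^bsub>S\<^esub>"
        by (simp only: S.zero_loc)
      then have "y = \<zero>\<^bsub>S\<^esub>"
        using S.fraction_inj[OF regS, of y "\<zero>\<^bsub>S\<^esub>"] y by simp
      then show False using y by simp
    qed
    ultimately show "J \<inter> ?K \<noteq> {\<zero>\<^bsub>?L\<^esub>}" by blast
  qed
  then show ?thesis
    unfolding is_aic_iff using m.ring_hom_cring_axioms inj S.rooted_loc[OF S] integral by blast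
qed

section \<open>The integral closure in an absolute integral closure of the ring of fractions\<close>

text \<open>\<open>T\<close> is the competitor of the localised \<open>S\<close> in the uniqueness
  claim.\<close>

locale loc_aic = loc_data R F + j: ring_hom_cring "loc R F" T j
  for R (structure) and F and T and j +
  assumes reg: "F \<subseteq> reg R" and aic: "is_aic (loc R F) T j"
begin

definition u where "u r = j (fraction R F r \<one>)"

text \<open>As a subset of \<open>T\<close> it gives a ring on the same element type, so that a
  uniqueness hypothesis about rings of that type can be applied to it.\<close>

definition T0 where "T0 = {t \<in> carrier T. integral_elt T (u ` carrier R) t}"

lemma u_hom: "ring_hom_cring R T u"
proof -
  interpret E: ring_hom_cring R "loc R F" "\<lambda>a. fraction R F a \<one>" by (rule fraction_hom)
  show ?thesis
    by (rule ring_hom_cringI[OF is_cring j.S.is_cring], rule ring_hom_memI) (simp_all add: u_def)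
qed

sublocale u: ring_hom_cring R T u by (rule u_hom)

lemma u_fraction: "a \<in> carrier R \<Longrightarrow> f \<in> F \<Longrightarrow> j (fraction R F a f) \<otimes>\<^bsub>T\<^esub> u f = u a"
  unfolding u_def by (subst j.hom_mult[symmetric]) (simp_all add: fraction_cancel)

lemma u_Units: "f \<in> F \<Longrightarrow> u f \<in> Units T"
proof -
  assume f: "f \<in> F"
  let ?v = "j (fraction R F \<one> f)"
  have "?v \<otimes>\<^bsub>T\<^esub> u f = \<one>\<^bsub>T\<^esub>"
    using u_fraction[of \<one> f] f by simp
  moreover have "?v \<in> carrier T" "u f \<in> carrier T"
    using f by simp_all
  ultimately show ?thesis
    using j.S.m_comm[of ?v "u f"] unfolding Units_def by auto
qed

lemma u_cancel: "f \<in> F \<Longrightarrow> x \<in> carrier T \<Longrightarrow> u f \<otimes>\<^bsub>T\<^esub> x = \<zero>\<^bsub>T\<^esub> \<Longrightarrow> x = \<zero>\<^bsub>T\<^esub>"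
  using j.S.Units_l_cancel[OF u_Units, of f x "\<zero>\<^bsub>T\<^esub>"] by simp

lemma u_inj: "inj_on u (carrier R)"
proof (rule inj_onI)
  fix a b assume ab: "a \<in> carrier R" "b \<in> carrier R" "u a = u b"
  have "inj_on j (carrier (loc R F))"
    using aic by (simp add: is_aic_iff)
  then have "fraction R F a \<one> = fraction R F b \<one>"
    using ab by (auto simp: u_def dest: inj_onD)
  then show "a = b"
    using fraction_inj[OF reg] ab by blast
qed

lemma K: "subring (u ` carrier R) T"
  by (rule u.carrier_image_subring)

lemma T0_subring: "subring T0 T"
  unfolding T0_def by (rule j.S.integral_closure_subring[OF K])

lemma T0_cring: "cring (T\<lparr>carrier := T0\<rparr>)"
  using j.S.subcring_iff[OF subringE(1)[OF T0_subring]] j.S.subcringI'[OF T0_subring] by blast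

lemma u_T0: "a \<in> carrier R \<Longrightarrow> u a \<in> T0"
  unfolding T0_def using j.S.integral_elt_base[OF K] by simp

text \<open>With \<open>w = u (f g)\<close>, the term \<open>k t^m\<close> times \<open>w^n\<close>
  is \<open>(w^(n-m) k) (w t)^m\<close>, and for a suitable \<open>f\<close> the new coefficient
  comes from \<open>R\<close>. The quantifier over \<open>g\<close> says that any multiple of
  \<open>f\<close> serves too, which lets the induction combine denominators.\<close>

lemma below_clear_denominator:
  assumes t: "t \<in> carrier T" and x: "x \<in> below T (j ` carrier (loc R F)) t n"
  shows "x \<in> carrier T \<and> (\<exists>f \<in> F. \<forall>g \<in> F. u (f \<otimes> g) [^]\<^bsub>T\<^esub> n \<otimes>\<^bsub>T\<^esub> x \<in> below T (u ` carrier R) (u (f \<otimes> g) \<otimes>\<^bsub>T\<^esub> t) n)"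
  using x
proof (induction n arbitrary: x)
  case 0
  have "F \<noteq> {}" using F.one_closed by blast
  then show ?case using 0 by auto
next
  case (Suc n)
  obtain y k where *: "x = y \<oplus>\<^bsub>T\<^esub> k \<otimes>\<^bsub>T\<^esub> t [^]\<^bsub>T\<^esub> n" "y \<in> below T (j ` carrier (loc R F)) t n"
      "k \<in> j ` carrier (loc R F)"
    using below_SucE[OF Suc.prems] by blast
  obtain r f2 where k: "k = j (fraction R F r f2)" "r \<in> carrier R" "f2 \<in> F"
    using *(3) by (auto elim!: loc_cases)
  obtain f1 where f1: "f1 \<in> F" "y \<in> carrier T"
      "\<And>g. g \<in> F \<Longrightarrow> u (f1 \<otimes> g) [^]\<^bsub>T\<^esub> n \<otimes>\<^bsub>T\<^esub> y \<in> below T (u ` carrier R) (u (f1 \<otimes> g) \<otimes>\<^bsub>T\<^esub> t) n"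
    using Suc.IH[OF *(2)] by blast
  have kcl: "k \<in> carrier T" using k by simp
  have "u (f1 \<otimes> f2 \<otimes> g) [^]\<^bsub>T\<^esub> Suc n \<otimes>\<^bsub>T\<^esub> x \<in> below T (u ` carrier R) (u (f1 \<otimes> f2 \<otimes> g) \<otimes>\<^bsub>T\<^esub> t) (Suc n)"
    if g: "g \<in> F" for g
  proof -
    \<comment> \<open>The induction hypothesis is used with \<open>f2 g\<close> in place of
      \<open>g\<close>, and the factor \<open>f2\<close> removes the denominator of the new
      coefficient.\<close>
    define w where "w = u (f1 \<otimes> f2 \<otimes> g)"
    have w: "w = u (f1 \<otimes> (f2 \<otimes> g))" "w \<in> carrier T" "w \<in> u ` carrier R"
      using f1(1) k(3) g by (simp_all add: w_def m_assoc del: u.hom_mult)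
    have wt: "w \<otimes>\<^bsub>T\<^esub> t \<in> carrier T" using w t by simp
    have "w [^]\<^bsub>T\<^esub> n \<otimes>\<^bsub>T\<^esub> y \<in> below T (u ` carrier R) (w \<otimes>\<^bsub>T\<^esub> t) n"
      unfolding w(1) using f1(3) k g by simp
    then have 1: "w \<otimes>\<^bsub>T\<^esub> (w [^]\<^bsub>T\<^esub> n \<otimes>\<^bsub>T\<^esub> y) \<in> below T (u ` carrier R) (w \<otimes>\<^bsub>T\<^esub> t) n"
      by (rule j.S.below_smult[OF K wt w(3)])
    have "w \<otimes>\<^bsub>T\<^esub> k = u f1 \<otimes>\<^bsub>T\<^esub> u g \<otimes>\<^bsub>T\<^esub> (k \<otimes>\<^bsub>T\<^esub> u f2)"
      unfolding w_def using f1 k(2,3) g kcl by (simp add: j.S.m_ac)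
    also have "\<dots> = u (f1 \<otimes> g \<otimes> r)"
      unfolding k(1) u_fraction[OF k(2,3)] using f1 k g by simp
    finally have wk: "w \<otimes>\<^bsub>T\<^esub> k \<in> u ` carrier R"
      by (rule image_eqI) (use f1(1) k(2) g in simp)
    \<comment> \<open>Of the \<open>n + 1\<close> factors \<open>w\<close>, one multiplies the
      coefficient \<open>k\<close>, and the remaining \<open>n\<close> are absorbed into the power
      of \<open>t\<close>.\<close>
    have "w [^]\<^bsub>T\<^esub> Suc n \<otimes>\<^bsub>T\<^esub> x
        = w \<otimes>\<^bsub>T\<^esub> (w [^]\<^bsub>T\<^esub> n \<otimes>\<^bsub>T\<^esub> y) \<oplus>\<^bsub>T\<^esub> (w \<otimes>\<^bsub>T\<^esub> k) \<otimes>\<^bsub>T\<^esub> (w \<otimes>\<^bsub>T\<^esub> t) [^]\<^bsub>T\<^esub> n"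
    proof -
      have "w [^]\<^bsub>T\<^esub> Suc n \<otimes>\<^bsub>T\<^esub> x
          = w [^]\<^bsub>T\<^esub> Suc n \<otimes>\<^bsub>T\<^esub> y \<oplus>\<^bsub>T\<^esub> w [^]\<^bsub>T\<^esub> Suc n \<otimes>\<^bsub>T\<^esub> (k \<otimes>\<^bsub>T\<^esub> t [^]\<^bsub>T\<^esub> n)"
        unfolding *(1) using w(2) f1(2) kcl t by (intro j.S.r_distr) auto
      moreover have "w [^]\<^bsub>T\<^esub> Suc n \<otimes>\<^bsub>T\<^esub> y = w \<otimes>\<^bsub>T\<^esub> (w [^]\<^bsub>T\<^esub> n \<otimes>\<^bsub>T\<^esub> y)"
        using w(2) f1(2) by (simp add: j.S.m_ac)
      moreover have "w [^]\<^bsub>T\<^esub> Suc n \<otimes>\<^bsub>T\<^esub> (k \<otimes>\<^bsub>T\<^esub> t [^]\<^bsub>T\<^esub> n) = (w \<otimes>\<^bsub>T\<^esub> k) \<otimes>\<^bsub>T\<^esub> (w \<otimes>\<^bsub>T\<^esub> t) [^]\<^bsub>T\<^esub> n"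
        using w(2) kcl t by (simp add: j.S.nat_pow_distrib j.S.m_ac)
      ultimately show ?thesis by (simp only:)
    qed
    then show ?thesis
      unfolding w_def[symmetric] using below_SucI[OF 1 wk] by (simp only:)
  qed
  moreover have "x \<in> carrier T"
    unfolding *(1) using f1(2) kcl t by simp
  moreover have "f1 \<otimes> f2 \<in> F"
    using f1(1) k(3) by simp
  ultimately show ?case by blast
qed

text \<open>Multiplying an integral equation of degree \<open>n\<close> for \<open>t\<close> by
  \<open>(u f)^n\<close> gives one for \<open>u f\<close> times \<open>t\<close> with coefficients
  from \<open>R\<close>.\<close>

lemma clear_denominator:
  assumes t: "t \<in> carrier T"
  obtains f where "f \<in> F" "u f \<otimes>\<^bsub>T\<^esub> t \<in> T0"
proof -
  obtain n where n: "t [^]\<^bsub>T\<^esub> n \<in> below T (j ` carrier (loc R F)) t n"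
    using aic t unfolding is_aic_iff integral_elt_def by blast
  obtain f where f: "f \<in> F" "u (f \<otimes> \<one>) [^]\<^bsub>T\<^esub> n \<otimes>\<^bsub>T\<^esub> t [^]\<^bsub>T\<^esub> n \<in> below T (u ` carrier R) (u (f \<otimes> \<one>) \<otimes>\<^bsub>T\<^esub> t) n"
    using below_clear_denominator[OF t n] F.one_closed by blast
  then have "(u f \<otimes>\<^bsub>T\<^esub> t) [^]\<^bsub>T\<^esub> n \<in> below T (u ` carrier R) (u f \<otimes>\<^bsub>T\<^esub> t) n"
    using t by (simp add: j.S.nat_pow_distrib)
  then have "u f \<otimes>\<^bsub>T\<^esub> t \<in> T0"
    using t f by (auto simp: T0_def integral_elt_def)
  then show thesis using f that by blast
qed

lemma T0_rooted: "rooted (T\<lparr>carrier := T0\<rparr>)"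
  unfolding rooted_def
proof (intro allI impI)
  fix n :: nat and a assume n: "n > 0" and a: "\<forall>k<n. a k \<in> carrier (T\<lparr>carrier := T0\<rparr>)"
  then have a': "a k \<in> carrier T" "integral_elt T (u ` carrier R) (a k)" if "k < n" for k
    using that by (auto simp: T0_def)
  have "rooted T" using aic by (simp add: is_aic_iff)
  then obtain t where t: "t \<in> carrier T" "t [^]\<^bsub>T\<^esub> n \<oplus>\<^bsub>T\<^esub> psum T a t n = \<zero>\<^bsub>T\<^esub>"
    using n a'(1) unfolding rooted_def by blast
  then have "t \<in> T0"
    unfolding T0_def using j.S.integral_elt_trans[OF K t(1) a'(2) t(2)] by simp
  then show "\<exists>s \<in> carrier (T\<lparr>carrier := T0\<rparr>). s [^]\<^bsub>T\<lparr>carrier := T0\<rparr>\<^esub> n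
      \<oplus>\<^bsub>T\<lparr>carrier := T0\<rparr>\<^esub> psum (T\<lparr>carrier := T0\<rparr>) a s n = \<zero>\<^bsub>T\<lparr>carrier := T0\<rparr>\<^esub>"
    using t by auto
qed

lemma T0_tight: "tight R (T\<lparr>carrier := T0\<rparr>) u"
  unfolding tight_def
proof (intro allI impI)
  fix J assume J: "ideal J (T\<lparr>carrier := T0\<rparr>)" "J \<noteq> {\<zero>\<^bsub>T\<lparr>carrier := T0\<rparr>\<^esub>}"
  interpret J: ideal J "T\<lparr>carrier := T0\<rparr>" by (rule J(1))
  have T0: "t \<in> carrier T" if "t \<in> T0" for t
    using that by (simp add: T0_def)
  have Jcl: "x \<in> T0" if "x \<in> J" for x
    using J.Icarr[OF that] by simp
  have Jmult: "a \<otimes>\<^bsub>T\<^esub> x \<in> J" if "x \<in> J" "a \<in> T0" for a x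
    using J.I_l_closed[of x a] that by simp
  have Jadd: "x \<oplus>\<^bsub>T\<^esub> y \<in> J" if "x \<in> J" "y \<in> J" for x y
    using additive_subgroup.a_closed[OF ideal.axioms(1)[OF J(1)] that] by simp
  have Jz: "\<zero>\<^bsub>T\<^esub> \<in> J"
    using additive_subgroup.zero_closed[OF ideal.axioms(1)[OF J(1)]] by simp
  \<comment> \<open>This is the extension of \<open>J\<close> to \<open>T\<close>, described by
    denominators.\<close>
  let ?J = "{x \<in> carrier T. \<exists>f \<in> F. u f \<otimes>\<^bsub>T\<^esub> x \<in> J}"
  have "u \<one> \<otimes>\<^bsub>T\<^esub> \<zero>\<^bsub>T\<^esub> \<in> J"
    using Jz by simp
  then have zJ: "\<zero>\<^bsub>T\<^esub> \<in> ?J"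
    using F.one_closed by blast
  have JI: "ideal ?J T"
  proof (rule idealI[OF j.S.ring_axioms])
    \<comment> \<open>A multiplier \<open>x\<close> from \<open>T\<close> need not lie in
      \<open>T0\<close>; a second denominator \<open>g\<close> moves it there.\<close>
    show mult: "x \<otimes>\<^bsub>T\<^esub> a \<in> ?J" if a: "a \<in> ?J" and x: "x \<in> carrier T" for a x
    proof -
      obtain f where f: "f \<in> F" "u f \<otimes>\<^bsub>T\<^esub> a \<in> J" "a \<in> carrier T" using a by blast
      obtain g where g: "g \<in> F" "u g \<otimes>\<^bsub>T\<^esub> x \<in> T0" using clear_denominator[OF x] by blast
      have "u (g \<otimes> f) \<otimes>\<^bsub>T\<^esub> (x \<otimes>\<^bsub>T\<^esub> a) = (u g \<otimes>\<^bsub>T\<^esub> x) \<otimes>\<^bsub>T\<^esub> (u f \<otimes>\<^bsub>T\<^esub> a)"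
        using f g x by (simp add: j.S.m_ac)
      then show ?thesis
        using Jmult[OF f(2) g(2)] f g x by (auto intro!: bexI[of _ "g \<otimes> f"])
    qed
    show "a \<otimes>\<^bsub>T\<^esub> x \<in> ?J" if a: "a \<in> ?J" and x: "x \<in> carrier T" for a x
      using mult[OF a x] a x by (simp add: j.S.m_comm)
    show "subgroup ?J (add_monoid T)"
    proof (rule j.S.add.subgroupI)
      show "?J \<subseteq> carrier T" by blast
      show "?J \<noteq> {}" using zJ by blast
      show "\<ominus>\<^bsub>T\<^esub> a \<in> ?J" if a: "a \<in> ?J" for a
      proof -
        have "\<ominus>\<^bsub>T\<^esub> \<one>\<^bsub>T\<^esub> \<otimes>\<^bsub>T\<^esub> a = \<ominus>\<^bsub>T\<^esub> a"
          using a by (simp add: j.S.l_minus)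
        then show ?thesis
          using mult[OF a, of "\<ominus>\<^bsub>T\<^esub> \<one>\<^bsub>T\<^esub>"] by simp
      qed
      show "a \<oplus>\<^bsub>T\<^esub> b \<in> ?J" if ab: "a \<in> ?J" "b \<in> ?J" for a b
      proof -
        obtain f g where f: "f \<in> F" "u f \<otimes>\<^bsub>T\<^esub> a \<in> J" "a \<in> carrier T"
            and g: "g \<in> F" "u g \<otimes>\<^bsub>T\<^esub> b \<in> J" "b \<in> carrier T"
          using ab by blast
        have "u (f \<otimes> g) \<otimes>\<^bsub>T\<^esub> (a \<oplus>\<^bsub>T\<^esub> b) = u g \<otimes>\<^bsub>T\<^esub> (u f \<otimes>\<^bsub>T\<^esub> a) \<oplus>\<^bsub>T\<^esub> u f \<otimes>\<^bsub>T\<^esub> (u g \<otimes>\<^bsub>T\<^esub> b)"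
          using f g by (simp add: j.S.r_distr j.S.l_distr j.S.m_ac)
        then have "u (f \<otimes> g) \<otimes>\<^bsub>T\<^esub> (a \<oplus>\<^bsub>T\<^esub> b) \<in> J"
          using Jadd[OF Jmult[OF f(2) u_T0] Jmult[OF g(2) u_T0]] f g by simp
        then show ?thesis
          using f g by (auto intro!: bexI[of _ "f \<otimes> g"])
      qed
    qed
  qed
  obtain x where x: "x \<in> J" "x \<noteq> \<zero>\<^bsub>T\<^esub>"
    using not_zero_singletonD[OF J(2)] Jz by auto
  then have "x \<in> ?J"
    using T0 Jcl F.one_closed by (auto intro!: bexI[of _ \<one>])
  then have "?J \<noteq> {\<zero>\<^bsub>T\<^esub>}"
    using x by blast
  moreover have "tight (loc R F) T j" using aic by (simp add: is_aic_iff)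
  ultimately have ne: "?J \<inter> j ` carrier (loc R F) \<noteq> {\<zero>\<^bsub>T\<^esub>}"
    using JI unfolding tight_def by blast
  have "\<zero>\<^bsub>T\<^esub> \<in> ?J \<inter> j ` carrier (loc R F)"
    using zJ j.hom_zero[symmetric] j.R.zero_closed by blast
  then obtain y where y: "y \<in> ?J \<inter> j ` carrier (loc R F)" "y \<noteq> \<zero>\<^bsub>T\<^esub>"
    by (rule not_zero_singletonD[OF ne])
  then obtain r g where r: "y = j (fraction R F r g)" "r \<in> carrier R" "g \<in> F"
    by (auto elim!: loc_cases)
  obtain f where f: "f \<in> F" "u f \<otimes>\<^bsub>T\<^esub> y \<in> J"
    using y by blast
  have ycl: "y \<in> carrier T" using y by blast
  \<comment> \<open>Clearing the denominator \<open>g\<close> of \<open>y\<close> as well produces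
    an element that is in \<open>J\<close> and comes from \<open>R\<close>.\<close>
  have "u g \<otimes>\<^bsub>T\<^esub> (u f \<otimes>\<^bsub>T\<^esub> y) = u f \<otimes>\<^bsub>T\<^esub> (y \<otimes>\<^bsub>T\<^esub> u g)"
    using f r(3) ycl by (simp add: j.S.m_ac)
  also have "\<dots> = u (f \<otimes> r)"
    unfolding r(1) u_fraction[OF r(2,3)] using f r by simp
  finally have eq: "u g \<otimes>\<^bsub>T\<^esub> (u f \<otimes>\<^bsub>T\<^esub> y) = u (f \<otimes> r)" .
  have "u (f \<otimes> r) \<in> J \<inter> u ` carrier R"
    using Jmult[OF f(2) u_T0[of g]] r(2,3) f(1) imageI[of "f \<otimes> r" "carrier R" u] unfolding eq
    by (simp del: u.hom_mult)
  \<comment> \<open>Both factors \<open>u f\<close> and \<open>u g\<close> are units of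
    \<open>T\<close> and can be cancelled, while \<open>y\<close> is nonzero.\<close>
  moreover have "u (f \<otimes> r) \<noteq> \<zero>\<^bsub>T\<^esub>"
  proof
    assume "u (f \<otimes> r) = \<zero>\<^bsub>T\<^esub>"
    moreover have "u f \<otimes>\<^bsub>T\<^esub> y \<in> carrier T"
      using f(1) ycl by simp
    ultimately have "u f \<otimes>\<^bsub>T\<^esub> y = \<zero>\<^bsub>T\<^esub>"
      using u_cancel[OF r(3)] eq by metis
    then show False
      using u_cancel[OF f(1) ycl] y(2) by blast
  qed
  ultimately have "J \<inter> u ` carrier R \<noteq> {\<zero>\<^bsub>T\<^esub>}"
    by blast
  then show "J \<inter> u ` carrier R \<noteq> {\<zero>\<^bsub>T\<lparr>carrier := T0\<rparr>\<^esub>}"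
    by simp
qed

lemma T0_aic: "is_aic R (T\<lparr>carrier := T0\<rparr>) u"
  unfolding is_aic_iff
proof (intro conjI ballI)
  show "ring_hom_cring R (T\<lparr>carrier := T0\<rparr>) u"
    by (rule ring_hom_cringI[OF is_cring T0_cring], rule ring_hom_memI) (simp_all add: u_T0)
  \<comment> \<open>Powers and \<open>below\<close> are the same in \<open>T0\<close> as in
    \<open>T\<close>, so this is membership in \<open>T0\<close>.\<close>
  show "integral_elt (T\<lparr>carrier := T0\<rparr>) (u ` carrier R) s" if "s \<in> carrier (T\<lparr>carrier := T0\<rparr>)" for s
    using that by (simp add: T0_def integral_elt_def)
qed (rule u_inj T0_rooted T0_tight)+

lemma loc_isomorphic:
  assumes i: "ring_hom_cring R S i" and iso: "algebra_isomorphic R S i (T\<lparr>carrier := T0\<rparr>) u"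
  shows "algebra_isomorphic (loc R F) (loc S (i ` F)) (loc_map S F i) T j"
proof -
  obtain h where h: "h \<in> ring_iso S (T\<lparr>carrier := T0\<rparr>)" "\<And>r. r \<in> carrier R \<Longrightarrow> h (i r) = u r"
    using iso unfolding algebra_isomorphic_def by blast
  interpret i: ring_hom_cring R S i by fact
  interpret S: loc_data S "i ` F" by (rule loc_data_image[OF loc_data_axioms i])
  note frac = loc_map_fraction[OF loc_data_axioms i]
  have bij: "bij_betw h (carrier S) T0" and hhom: "h \<in> ring_hom S (T\<lparr>carrier := T0\<rparr>)"
    using h(1) by (auto simp: ring_iso_def)
  interpret h: ring_hom_cring S T h
  proof (rule ring_hom_cringI[OF i.S.is_cring j.S.is_cring], rule ring_hom_memI)
    show "h x \<in> carrier T" if "x \<in> carrier S" for x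
      using ring_hom_closed[OF hhom that] by (simp add: T0_def)
  qed (use ring_hom_mult[OF hhom] ring_hom_add[OF hhom] ring_hom_one[OF hhom] in auto)
  have "h ` i ` F \<subseteq> Units T"
    using h(2) u_Units by auto
  then obtain H where Hhom: "H \<in> ring_hom (loc S (i ` F)) T"
    and H: "\<And>a f. a \<in> carrier S \<Longrightarrow> f \<in> i ` F \<Longrightarrow> H (fraction S (i ` F) a f) \<otimes>\<^bsub>T\<^esub> h f = h a"
    using S.loc_lift[OF h.ring_hom_cring_axioms] by blast
  have HF: "H (fraction S (i ` F) a (i f)) \<otimes>\<^bsub>T\<^esub> u f = h a" if "a \<in> carrier S" "f \<in> F" for a f
    using H[of a "i f"] h(2)[of f] that by simp
  have Hcl: "H x \<in> carrier T" if "x \<in> carrier (loc S (i ` F))" for x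
    using ring_hom_closed[OF Hhom that] .
  have cancel: "x = y" if "x \<otimes>\<^bsub>T\<^esub> u f = y \<otimes>\<^bsub>T\<^esub> u f" "f \<in> F" "x \<in> carrier T" "y \<in> carrier T" for x y f
    using that j.S.Units_l_cancel[OF u_Units, of f x y] by (simp add: j.S.m_comm)
  have "inj_on H (carrier (loc S (i ` F)))"
  proof (rule inj_onI)
    fix x y assume "x \<in> carrier (loc S (i ` F))" "y \<in> carrier (loc S (i ` F))" and eq: "H x = H y"
    then obtain a f b g where x: "x = fraction S (i ` F) a (i f)" "a \<in> carrier S" "f \<in> F"
        and y: "y = fraction S (i ` F) b (i g)" "b \<in> carrier S" "g \<in> F"
      by (auto elim!: S.loc_cases)
    have z: "H y \<in> carrier T" using y by (auto intro: Hcl)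
    have "h (a \<otimes>\<^bsub>S\<^esub> i g) = (H y \<otimes>\<^bsub>T\<^esub> u f) \<otimes>\<^bsub>T\<^esub> u g"
      using HF[OF x(2,3), folded x(1)] eq x y h(2) by simp
    also have "\<dots> = (H y \<otimes>\<^bsub>T\<^esub> u g) \<otimes>\<^bsub>T\<^esub> u f"
      using z x y by (simp add: j.S.m_ac)
    also have "\<dots> = h (b \<otimes>\<^bsub>S\<^esub> i f)"
      using HF[OF y(2,3), folded y(1)] x y h(2) by simp
    finally have "a \<otimes>\<^bsub>S\<^esub> i g = b \<otimes>\<^bsub>S\<^esub> i f"
      using x y by (intro inj_onD[OF bij_betw_imp_inj_on[OF bij]]) simp_all
    then show "x = y"
      unfolding x(1) y(1) using x y by (intro S.fraction_eqI) auto
  qed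
  moreover have "\<exists>x \<in> carrier (loc S (i ` F)). H x = t" if t: "t \<in> carrier T" for t
  proof -
    obtain f where f: "f \<in> F" "u f \<otimes>\<^bsub>T\<^esub> t \<in> T0"
      using clear_denominator[OF t] by blast
    then have "u f \<otimes>\<^bsub>T\<^esub> t \<in> h ` carrier S"
      unfolding bij_betw_imp_surj_on[OF bij] by simp
    then obtain s where s: "s \<in> carrier S" "u f \<otimes>\<^bsub>T\<^esub> t = h s"
      by blast
    have x: "fraction S (i ` F) s (i f) \<in> carrier (loc S (i ` F))"
      using s f by simp
    \<comment> \<open>The preimage of \<open>t\<close> is \<open>s/f\<close>, where \<open>f\<close>
      moves \<open>t\<close> into \<open>T0\<close> and \<open>s\<close> corresponds to the result
      under \<open>h\<close>.\<close>
    have "H (fraction S (i ` F) s (i f)) = t"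
      using HF[OF s(1) f(1), folded s(2)] f(1) t j.S.m_comm[of "u f" t]
      by (intro cancel[OF _ f(1) Hcl[OF x] t]) simp
    then show ?thesis using x by blast
  qed
  ultimately have "bij_betw H (carrier (loc S (i ` F))) (carrier T)"
    using Hcl by (auto simp: bij_betw_def)
  then have "H \<in> ring_iso (loc S (i ` F)) T"
    using Hhom by (simp add: ring_iso_def)
  moreover have "H (loc_map S F i x) = j x" if x: "x \<in> carrier (loc R F)" for x
  proof -
    obtain r f where r: "x = fraction R F r f" "r \<in> carrier R" "f \<in> F"
      by (rule loc_cases[OF x])
    have cl: "fraction S (i ` F) (i r) (i f) \<in> carrier (loc S (i ` F))"
      using r by simp
    have "H (fraction S (i ` F) (i r) (i f)) \<otimes>\<^bsub>T\<^esub> u f = j x \<otimes>\<^bsub>T\<^esub> u f"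
      using HF[of "i r" f] u_fraction[OF r(2,3)] r h(2) by simp
    then have "H (fraction S (i ` F) (i r) (i f)) = j x"
      using r(3) Hcl[OF cl] j.hom_closed[OF x] by (rule cancel)
    then show ?thesis using r frac by simp
  qed
  ultimately show ?thesis
    unfolding algebra_isomorphic_def by blast
qed

end

section \<open>Localisation and uniqueness combined\<close>

theorem proposition4:
  fixes R :: "('a, 'm) ring_scheme" and S :: "('b, 'n) ring_scheme"
    and i :: "'a \<Rightarrow> 'b" and F :: "'a set"
  assumes "cring R"
    and "is_aic R S i"
    and "submonoid F R" and "F \<subseteq> reg R"
  shows "is_aic (loc R F) (loc S (i ` F)) (loc_map S F i)
    \<and> i ` F \<subseteq> reg S
    \<and> (is_unique_aic TYPE('t) R S i \<longrightarrow>
         is_unique_aic TYPE('t) (loc R F) (loc S (i ` F)) (loc_map S F i))"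
proof -
  have loc: "loc_data R F"
    using assms(1,3) by (simp add: loc_data_def)
  have i: "ring_hom_cring R S i"
    using assms(2) by (simp add: is_aic_iff)
  have aic: "is_aic (loc R F) (loc S (i ` F)) (loc_map S F i)"
    by (rule is_aic_loc[OF loc assms(4,2)])
  have "i ` F \<subseteq> reg S"
    using assms(2) by (intro tight_extension_reg[OF _ _ assms(4)]) (auto simp: is_aic_def)
  moreover have "algebra_isomorphic (loc R F) (loc S (i ` F)) (loc_map S F i) T j"
    if unique: "is_unique_aic TYPE('t) R S i" and T: "is_aic (loc R F) T j" for T :: "'t ring" and j
  proof -
    have "ring_hom_cring (loc R F) T j"
      using T by (simp add: is_aic_iff)
    then interpret T: loc_aic R F T j
      using loc T assms(4) by (simp add: loc_aic_def loc_aic_axioms_def)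
    \<comment> \<open>The hypothesis of uniqueness is applied to the aic \<open>T0\<close> of
      \<open>R\<close>, whose elements have the type \<open>'t\<close> of those of
      \<open>T\<close>.\<close>
    show ?thesis
      using unique T.T0_aic by (intro T.loc_isomorphic[OF i]) (auto simp: is_unique_aic_def)
  qed
  ultimately show ?thesis
    using aic unfolding is_unique_aic_def by blast
qed

end
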